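(* Let $0\le s<n$ and let $\mathcal{L}$ be an $s$-dimensional affine subspace of $\mathbb{R}^n$ with $(s+1)\times(n-s)$ real parametrizing matrix $A$, i.e. $\mathcal{L}=\{(\mathbf{x},\tilde{\mathbf{x}}A):\mathbf{x}\in\mathbb{R}^s\}$ where $\tilde{\mathbf{x}}=(1,\mathbf{x})$. Suppose that either (a) all the columns of $A$ are rational multiples of one column, or (b) all the rows of $A$ are rational multiples of one row. Then $A$ is not $n$-singular if and only if $\lambda_{\mathcal{L}}$-almost every point of $\mathcal{L}$ is not singular, where $\lambda_{\mathcal{L}}$ is the Haar (Lebesgue) measure on $\mathcal{L}$.
   Context: $\Vert\cdot\Vert$ denotes the max norm. A vector $\mathbf{x}\in\mathbb{R}^n$ is singular if for every $c>0$ and all sufficiently large $Q>0$ there exist $\mathbf{0}\neq\mathbf{q}\in\mathbb{Z}^n$, $q_0\in\mathbb{Z}$ with $|\mathbf{q}\cdot\mathbf{x}+q_0|<c/Q^n$ and $\Vert\mathbf{q}\Vert\le Q$. For $\omega>0$, a real $k\times l$ matrix $A$ is called $\omega$-singular if for every $c>0$ and all sufficiently large $Q>0$ there exist $\mathbf{0}\neq\mathbf{q}\in\mathbb{Z}^l$ and $\mathbf{p}\in\mathbb{Z}^k$ with $\Vert A\mathbf{q}+\mathbf{p}\Vert<c/Q^{\omega}$ and $\Vert\mathbf{q}\Vert\le Q$. Vectors $\mathbf{x},\tilde{\mathbf{x}}$ are row vectors. *)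

theory Defs
  imports "HOL-Analysis.Analysis"
begin

text \<open>
  The dimensions \<open>s\<close> (possibly \<open>0\<close>) and \<open>n\<close> vary within one statement, so they are not encoded in
  types. A point of \<open>\<real>\<^sup>n\<close> is an element of \<open>{..<n} \<rightarrow>\<^sub>E UNIV\<close>, the underlying set of the product measure
  space, with coordinates numbered from \<open>0\<close>. A real \<open>k \<times> l\<close> matrix is a function \<open>A\<close> whose entries are
  \<open>A i j\<close> for \<open>i < k\<close> and \<open>j < l\<close>, and an integer vector of length \<open>l\<close> is a function on \<open>{..<l}\<close>; values
  outside these index ranges are never used.
\<close>

text \<open>The additional \<open>0\<close> only matters for vectors of length \<open>0\<close>.\<close>

definition max_norm :: "nat \<Rightarrow> (nat \<Rightarrow> real) \<Rightarrow> real" where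
  "max_norm d v = Max (insert 0 ((\<lambda>i. \<bar>v i\<bar>) ` {..<d}))"

definition singular_vector :: "nat \<Rightarrow> (nat \<Rightarrow> real) \<Rightarrow> bool" where
  "singular_vector n x \<longleftrightarrow>
    (\<forall>c>0. \<forall>\<^sub>F Q :: real in at_top.
      \<exists>(q :: nat \<Rightarrow> int) (q\<^sub>0 :: int).
        (\<exists>i<n. q i \<noteq> 0) \<and>
        \<bar>(\<Sum>i<n. of_int (q i) * x i) + of_int q\<^sub>0\<bar> < c / Q ^ n \<and>
        max_norm n (\<lambda>i. of_int (q i)) \<le> Q)"

definition omega_singular_matrix ::
  "nat \<Rightarrow> nat \<Rightarrow> real \<Rightarrow> (nat \<Rightarrow> nat \<Rightarrow> real) \<Rightarrow> bool" where
  "omega_singular_matrix k l \<omega> A \<longleftrightarrow>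
    (\<forall>c>0. \<forall>\<^sub>F Q :: real in at_top.
      \<exists>(q :: nat \<Rightarrow> int) (p :: nat \<Rightarrow> int).
        (\<exists>j<l. q j \<noteq> 0) \<and>
        max_norm k (\<lambda>i. (\<Sum>j<l. A i j * of_int (q j)) + of_int (p i)) < c / Q powr \<omega> \<and>
        max_norm l (\<lambda>j. of_int (q j)) \<le> Q)"

definition columns_rational_multiples :: "nat \<Rightarrow> nat \<Rightarrow> (nat \<Rightarrow> nat \<Rightarrow> real) \<Rightarrow> bool" where
  "columns_rational_multiples k l A \<longleftrightarrow>
    (\<exists>j\<^sub>0<l. \<forall>j<l. \<exists>r\<in>\<rat>. \<forall>i<k. A i j = r * A i j\<^sub>0)"

definition rows_rational_multiples :: "nat \<Rightarrow> nat \<Rightarrow> (nat \<Rightarrow> nat \<Rightarrow> real) \<Rightarrow> bool" where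
  "rows_rational_multiples k l A \<longleftrightarrow>
    (\<exists>i\<^sub>0<k. \<forall>i<k. \<exists>r\<in>\<rat>. \<forall>j<l. A i j = r * A i\<^sub>0 j)"

text \<open>The map \<open>x \<mapsto> (x, (1, x) A)\<close> from \<open>\<real>\<^sup>s\<close> to \<open>\<real>\<^sup>n\<close>; \<open>case_nat 1 x\<close> is the row vector \<open>(1, x)\<close>.\<close>

definition affine_param ::
  "nat \<Rightarrow> nat \<Rightarrow> (nat \<Rightarrow> nat \<Rightarrow> real) \<Rightarrow> (nat \<Rightarrow> real) \<Rightarrow> nat \<Rightarrow> real" where
  "affine_param s n A x =
    (\<lambda>j\<in>{..<n}. if j < s then x j else (\<Sum>i<s+1. case_nat 1 x i * A i (j - s)))"

definition affine_subspace :: "nat \<Rightarrow> nat \<Rightarrow> (nat \<Rightarrow> nat \<Rightarrow> real) \<Rightarrow> (nat \<Rightarrow> real) set" where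
  "affine_subspace s n A = affine_param s n A ` ({..<s} \<rightarrow>\<^sub>E UNIV)"

text \<open>
  Haar measure on the affine subspace, on its Borel sets: the image of Lebesgue measure on \<open>\<real>\<^sup>s\<close> under
  the parametrization. It agrees with \<open>s\<close>-dimensional Lebesgue (surface) measure up to a positive
  constant, the Jacobian of the parametrization. For \<open>s = 0\<close> it is the unit mass at the only point.
\<close>

definition haar_affine :: "nat \<Rightarrow> nat \<Rightarrow> (nat \<Rightarrow> nat \<Rightarrow> real) \<Rightarrow> (nat \<Rightarrow> real) measure" where
  "haar_affine s n A =
    distr (\<Pi>\<^sub>M i\<in>{..<s}. lborel)
      (restrict_space (\<Pi>\<^sub>M i\<in>{..<n}. borel) (affine_subspace s n A))
      (affine_param s n A)"

lemma space_haar_affine: "space (haar_affine s n A) = affine_subspace s n A"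
  by (auto simp: haar_affine_def space_restrict_space space_PiM affine_subspace_def affine_param_def)

lemma measurable_affine_param:
  "affine_param s n A \<in>
    (\<Pi>\<^sub>M i\<in>{..<s}. lborel) \<rightarrow>\<^sub>M restrict_space (\<Pi>\<^sub>M i\<in>{..<n}. borel) (affine_subspace s n A)"
proof (rule measurable_restrict_space2)
  show "affine_param s n A \<in> space (\<Pi>\<^sub>M i\<in>{..<s}. lborel) \<rightarrow> affine_subspace s n A"
    by (auto simp: affine_subspace_def space_PiM)
  have coord: "(\<lambda>x. x i) \<in> borel_measurable (\<Pi>\<^sub>M i\<in>{..<s}. (lborel :: real measure))" if "i < s" for i
    using measurable_component_singleton[of i "{..<s}" "\<lambda>_. lborel :: real measure"] that by simp
  have tilde: "(\<lambda>x. case_nat 1 x i) \<in> borel_measurable (\<Pi>\<^sub>M i\<in>{..<s}. (lborel :: real measure))"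
    if "i < s + 1" for i
    using that by (cases i) (auto intro: coord)
  show "affine_param s n A \<in> (\<Pi>\<^sub>M i\<in>{..<s}. lborel) \<rightarrow>\<^sub>M (\<Pi>\<^sub>M i\<in>{..<n}. borel)"
    unfolding affine_param_def
  proof (rule measurable_restrict)
    fix j assume "j \<in> {..<n}"
    show "(\<lambda>x. if j < s then x j else (\<Sum>i<s+1. case_nat 1 x i * A i (j - s)))
      \<in> (\<Pi>\<^sub>M i\<in>{..<s}. lborel) \<rightarrow>\<^sub>M borel"
      by (cases "j < s")
        (auto intro!: coord borel_measurable_sum borel_measurable_times tilde simp del: sum.lessThan_Suc)
  qed
qed

lemma distr_translate_PiM_lborel:
  fixes t :: "nat \<Rightarrow> real"
  shows "distr (\<Pi>\<^sub>M i\<in>{..<s}. lborel) (\<Pi>\<^sub>M i\<in>{..<s}. lborel) (\<lambda>x. \<lambda>i\<in>{..<s}. t i + x i)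
    = (\<Pi>\<^sub>M i\<in>{..<s}. lborel)"
proof -
  interpret product_sigma_finite "\<lambda>_ :: nat. lborel :: real measure"
    by standard
  have meas: "(\<lambda>x. \<lambda>i\<in>{..<s}. t i + x i) \<in> (\<Pi>\<^sub>M i\<in>{..<s}. lborel) \<rightarrow>\<^sub>M (\<Pi>\<^sub>M i\<in>{..<s}. lborel)"
    by (rule measurable_restrict) simp
  show ?thesis
  proof (rule PiM_eqI)
    fix B :: "nat \<Rightarrow> real set"
    assume B: "\<And>i. i \<in> {..<s} \<Longrightarrow> B i \<in> sets lborel"
    have pre: "(\<lambda>x. \<lambda>i\<in>{..<s}. t i + x i) -` Pi\<^sub>E {..<s} B \<inter> space (\<Pi>\<^sub>M i\<in>{..<s}. lborel)
      = Pi\<^sub>E {..<s} (\<lambda>i. (+) (t i) -` B i)"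
      by (auto simp: space_PiM PiE_iff)
    have pre_sets: "(+) (t i) -` B i \<in> sets borel" if "i < s" for i
      using measurable_sets[of "(+) (t i)" borel borel "B i"] B[of i] that by simp
    have "emeasure lborel ((+) (t i) -` B i) = emeasure lborel (B i)" if "i < s" for i
    proof -
      have "emeasure lborel (B i) = emeasure (distr lborel borel ((+) (t i))) (B i)"
        by (simp add: lborel_distr_plus)
      also have "\<dots> = emeasure lborel ((+) (t i) -` B i)"
        using B[of i] that by (subst emeasure_distr) auto
      finally show ?thesis ..
    qed
    moreover have "Pi\<^sub>E {..<s} B \<in> sets (\<Pi>\<^sub>M i\<in>{..<s}. lborel)"
      by (rule sets_PiM_I_finite) (use B in auto)
    ultimately show "emeasure (distr (\<Pi>\<^sub>M i\<in>{..<s}. lborel) (\<Pi>\<^sub>M i\<in>{..<s}. lborel)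
        (\<lambda>x. \<lambda>i\<in>{..<s}. t i + x i)) (Pi\<^sub>E {..<s} B) = (\<Prod>i\<in>{..<s}. emeasure lborel (B i))"
      using meas pre_sets by (subst emeasure_distr) (simp_all only: pre, subst emeasure_PiM, simp_all)
  qed simp_all
qed

text \<open>Invariance under the translations of the affine subspace, whose vectors are the differences
  \<open>affine_param s n A t - affine_param s n A 0\<close>.\<close>

lemma haar_affine_translation_invariant:
  "distr (haar_affine s n A) (haar_affine s n A)
      (\<lambda>y. \<lambda>j\<in>{..<n}. (affine_param s n A t j - affine_param s n A (\<lambda>_. 0) j) + y j)
    = haar_affine s n A"
proof -
  let ?P = "\<Pi>\<^sub>M i\<in>{..<s}. (lborel :: real measure)"
  let ?R = "restrict_space (\<Pi>\<^sub>M i\<in>{..<n}. (borel :: real measure)) (affine_subspace s n A)"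
  let ?f = "affine_param s n A"
  let ?T = "\<lambda>y. \<lambda>j\<in>{..<n}. (?f t j - ?f (\<lambda>_. 0) j) + y j"
  let ?S = "\<lambda>x. \<lambda>i\<in>{..<s}. t i + x i"
  have comm: "?T (?f x) = ?f (?S x)" for x
  proof (rule ext)
    fix j
    have "(\<Sum>i<s. (t i + x i) * B i) = (\<Sum>i<s. t i * B i) + (\<Sum>i<s. x i * B i)" for B :: "nat \<Rightarrow> real"
      by (simp add: sum.distrib algebra_simps)
    then show "?T (?f x) j = ?f (?S x) j"
      by (auto simp: affine_param_def sum.lessThan_Suc_shift simp del: sum.lessThan_Suc)
  qed
  have S: "?S \<in> ?P \<rightarrow>\<^sub>M ?P"
    by (rule measurable_restrict) simp
  have "?T \<in> ?R \<rightarrow>\<^sub>M ?R"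
  proof (rule measurable_restrict_space2)
    show "?T \<in> space ?R \<rightarrow> affine_subspace s n A"
    proof
      fix y assume "y \<in> space ?R"
      then obtain x where "y = ?f x"
        by (auto simp: space_restrict_space affine_subspace_def)
      then have "?T y = ?f (?S x)"
        by (simp only: comm)
      then show "?T y \<in> affine_subspace s n A"
        unfolding affine_subspace_def by (simp only:) (rule imageI, simp add: PiE_iff extensional_def)
    qed
    have "?T \<in> (\<Pi>\<^sub>M i\<in>{..<n}. borel) \<rightarrow>\<^sub>M (\<Pi>\<^sub>M i\<in>{..<n}. borel)"
      by (rule measurable_restrict) simp
    then show "?T \<in> ?R \<rightarrow>\<^sub>M (\<Pi>\<^sub>M i\<in>{..<n}. borel)"
      by (rule measurable_restrict_space1)
  qed
  then have "distr (distr ?P ?R ?f) ?R ?T = distr ?P ?R (?T \<circ> ?f)"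
    by (intro distr_distr measurable_affine_param)
  also have "?T \<circ> ?f = ?f \<circ> ?S"
    using comm by (simp add: fun_eq_iff)
  also have "distr ?P ?R (?f \<circ> ?S) = distr (distr ?P ?P ?S) ?R ?f"
    by (intro distr_distr[symmetric] measurable_affine_param S)
  also have "\<dots> = distr ?P ?R ?f"
    by (simp only: distr_translate_PiM_lborel)
  finally have "distr (haar_affine s n A) ?R ?T = haar_affine s n A"
    by (simp only: haar_affine_def)
  moreover have "distr (haar_affine s n A) (haar_affine s n A) ?T = distr (haar_affine s n A) ?R ?T"
    by (rule distr_cong) (simp_all only: haar_affine_def sets_distr)
  ultimately show ?thesis
    by (simp only:)
qed

end

theory Submission
  imports Defs
begin

text \<open>
  For \<open>y = (x, (1, x) A)\<close> and \<open>q = (q', q'')\<close>, the form \<open>q \<cdot> y + q0\<close> equals \<open>(1, x) \<cdot> v\<close> with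
  \<open>v = A q'' + (q0, q')\<close>. Hence small values of \<open>v\<close> give small values of the form at every point, so an
  \<open>n\<close>-singular \<open>A\<close> makes every point singular.

  Conversely, let \<open>A\<close> satisfy \<open>\<parallel>v\<parallel> \<ge> c / Q ^ n\<close> for arbitrarily large \<open>Q\<close>, all \<open>0 < \<parallel>q''\<parallel> \<le> Q\<close> and all \<open>(q0, q')\<close>. In a fixed
  cube, the slab \<open>\<bar>(1, x) \<cdot> v\<bar> < \<epsilon> / Q ^ n\<close> has measure \<open>O(\<epsilon> / (Q ^ n \<parallel>v\<parallel>))\<close>. If \<open>s \<ge> 1\<close>, summing this over
  the \<open>v\<close> with \<open>\<parallel>v\<parallel> \<ge> \<kappa> / Q\<close> gives \<open>O(\<epsilon>)\<close>: for the \<open>O(Q ^ n)\<close> vectors \<open>q\<close> whose gradient is at least 1 the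
  translates by \<open>q0\<close> contribute \<open>O(\<epsilon> / Q ^ n)\<close> each, and for the other \<open>O(Q ^ (n - 1))\<close> vectors they contribute at most
  \<open>O(\<epsilon> / Q ^ (n - 1))\<close>. The rationality assumption enters for \<open>\<parallel>v\<parallel> < \<kappa> / Q\<close>: the
  expression \<open>v\<^sub>i - r\<^sub>i v\<^sub>j\<close> (rows \<open>r\<^sub>i\<close> times row \<open>j\<close>) or \<open>t w - t' v\<close> (columns, where \<open>v = t a + p\<close> and \<open>w = t' a + p'\<close> for
  the common column \<open>a\<close>) is rational with bounded denominator and too small to be nonzero, so all these \<open>v\<close> lie on
  one line. Since \<open>\<parallel>v\<parallel> \<ge> c / Q ^ n\<close>, their slabs are contained in a single slab of measure \<open>O(\<epsilon> / c)\<close>. So the set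
  of parameters that are bad at scale \<open>Q\<close> has measure \<open>O(\<epsilon>)\<close> uniformly in \<open>Q\<close>, and the lower limit
  of these sets along a sequence of such \<open>Q\<close>, intersected over \<open>\<epsilon>\<close>, is null.
  For \<open>s = 0\<close> there is only one point and the two notions of singularity coincide.
\<close>

section \<open>Max norm and coefficient vectors of linear forms\<close>

lemma max_norm_le_iff: "max_norm d v \<le> a \<longleftrightarrow> 0 \<le> a \<and> (\<forall>i<d. \<bar>v i\<bar> \<le> a)"
  unfolding max_norm_def by (subst Max_le_iff) auto

lemma max_norm_less_iff: "max_norm d v < a \<longleftrightarrow> 0 < a \<and> (\<forall>i<d. \<bar>v i\<bar> < a)"
  unfolding max_norm_def by (subst Max_less_iff) auto

lemma max_norm_nonneg: "0 \<le> max_norm d v"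
  unfolding max_norm_def by (rule Max_ge) auto

lemma abs_le_max_norm: "i < d \<Longrightarrow> \<bar>v i\<bar> \<le> max_norm d v"
  unfolding max_norm_def by (rule Max_ge) auto

lemma max_norm_attained:
  assumes "0 < max_norm d v"
  obtains i where "i < d" "\<bar>v i\<bar> = max_norm d v"
proof -
  have "max_norm d v \<in> insert 0 ((\<lambda>i. \<bar>v i\<bar>) ` {..<d})"
    unfolding max_norm_def by (rule Max_in) auto
  with assms that show thesis by auto
qed

text \<open>The pairing of \<open>v\<close> with \<open>(1, x)\<close>, so coordinate \<open>i\<close> of \<open>x\<close> meets coordinate \<open>Suc i\<close> of \<open>v\<close>.\<close>

definition affine_form :: "nat \<Rightarrow> (nat \<Rightarrow> real) \<Rightarrow> (nat \<Rightarrow> real) \<Rightarrow> real" where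
  "affine_form s v x = v 0 + (\<Sum>i<s. v (Suc i) * x i)"

definition approx_error ::
  "nat \<Rightarrow> (nat \<Rightarrow> nat \<Rightarrow> real) \<Rightarrow> (nat \<Rightarrow> int) \<Rightarrow> (nat \<Rightarrow> int) \<Rightarrow> nat \<Rightarrow> real" where
  "approx_error l A q p i = (\<Sum>j<l. A i j * of_int (q j)) + of_int (p i)"

text \<open>
  Splitting \<open>q \<in> \<int>\<^sup>n\<close> as \<open>(q', q'')\<close> after \<open>s\<close> coordinates, this is \<open>A q'' + (q0, q')\<close>, the coefficient
  vector of \<open>q \<cdot> y + q0\<close> as an affine function of the parameter of \<open>y\<close>.
\<close>

abbreviation tail_error ::
  "nat \<Rightarrow> nat \<Rightarrow> (nat \<Rightarrow> nat \<Rightarrow> real) \<Rightarrow> (nat \<Rightarrow> int) \<Rightarrow> int \<Rightarrow> nat \<Rightarrow> real" where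
  "tail_error s n A q q0 \<equiv> approx_error (n - s) A (\<lambda>j. q (s + j)) (case_nat q0 q)"

lemma sum_lessThan_split:
  fixes f :: "nat \<Rightarrow> real"
  assumes "s \<le> n"
  shows "(\<Sum>i<n. f i) = (\<Sum>i<s. f i) + (\<Sum>j<n - s. f (s + j))"
proof -
  have "{..<n} = {..<s} \<union> (+) s ` {..<n - s}"
  proof -
    have "x \<in> (+) s ` {..<n - s}" if "x < n" "\<not> x < s" for x
      using that by (intro image_eqI[of _ _ "x - s"]) auto
    with assms show ?thesis by auto
  qed
  moreover have "sum f ((+) s ` {..<n - s}) = (\<Sum>j<n - s. f (s + j))"
    by (subst sum.reindex) auto
  ultimately show ?thesis
    using sum.union_disjoint[of "{..<s}" "(+) s ` {..<n - s}" f] by (auto simp: disjoint_iff)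
qed

text \<open>Collecting coefficients: coordinate \<open>i < s\<close> contributes \<open>q i\<close>
  to the coefficient of \<open>x i\<close>, and exchanging the two sums adds row
  \<open>Suc i\<close> of \<open>A\<close> applied to the last \<open>n - s\<close> entries of
  \<open>q\<close>.\<close>

lemma dot_affine_param:
  assumes "s < n"
  shows "(\<Sum>i<n. of_int (q i) * affine_param s n A x i) + of_int q0
    = affine_form s (tail_error s n A q q0) x"
proof -
  have "(\<Sum>j<n - s. of_int (q (s + j)) * affine_param s n A x (s + j))
      = (\<Sum>j<n - s. of_int (q (s + j)) * (A 0 j + (\<Sum>i<s. x i * A (Suc i) j)))"
    by (rule sum.cong) (auto simp: affine_param_def sum.lessThan_Suc_shift simp del: sum.lessThan_Suc)
  also have "\<dots> = (\<Sum>j<n - s. A 0 j * of_int (q (s + j)))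
      + (\<Sum>j<n - s. \<Sum>i<s. A (Suc i) j * of_int (q (s + j)) * x i)"
    by (simp add: algebra_simps sum.distrib sum_distrib_left)
  also have "(\<Sum>j<n - s. \<Sum>i<s. A (Suc i) j * of_int (q (s + j)) * x i)
      = (\<Sum>i<s. (\<Sum>j<n - s. A (Suc i) j * of_int (q (s + j))) * x i)"
    by (subst sum.swap) (simp add: sum_distrib_right)
  finally have 1: "(\<Sum>j<n - s. of_int (q (s + j)) * affine_param s n A x (s + j))
    = (\<Sum>j<n - s. A 0 j * of_int (q (s + j)))
      + (\<Sum>i<s. (\<Sum>j<n - s. A (Suc i) j * of_int (q (s + j))) * x i)" .
  have 2: "(\<Sum>i<s. of_int (q i) * affine_param s n A x i) = (\<Sum>i<s. of_int (q i) * x i)"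
    using assms by (intro sum.cong) (auto simp: affine_param_def)
  show ?thesis
    using assms
    by (subst sum_lessThan_split[of s n])
       (simp_all add: 1 2 affine_form_def approx_error_def distrib_right sum.distrib)
qed

section \<open>Rational dependence and collinearity of small errors\<close>

lemma Ints_abs_less_1: "(a :: real) \<in> \<int> \<Longrightarrow> \<bar>a\<bar> < 1 \<Longrightarrow> a = 0"
  by (auto elim!: Ints_cases)

lemma common_denominator:
  fixes r :: "nat \<Rightarrow> real"
  assumes "\<And>i. i < k \<Longrightarrow> r i \<in> \<rat>"
  obtains N :: nat where "N > 0" "\<And>i. i < k \<Longrightarrow> r i * real N \<in> \<int>"
proof -
  have "\<exists>N::nat>0. \<forall>i<k. r i * real N \<in> \<int>"
    using assms
  proof (induction k)
    case (Suc k)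
    then obtain N :: nat where N: "N > 0" "\<forall>i<k. r i * real N \<in> \<int>"
      by (metis less_SucI)
    from Suc.prems[of k] obtain a :: int and b :: int where ab: "b > 0" "r k = of_int a / of_int b"
      by (auto elim!: Rats_cases')
    have "r k * real (N * nat b) = of_int (a * int N)"
      using ab by simp
    moreover have "r i * real (N * nat b) \<in> \<int>" if "i < k" for i
    proof -
      have "(r i * real N) * real (nat b) \<in> \<int>"
        by (rule Ints_mult[OF _ Ints_of_nat]) (use N(2) that in blast)
      then show ?thesis by (simp add: mult.assoc)
    qed
    ultimately show ?case
      using N ab by (intro exI[of _ "N * nat b"]) (auto simp: less_Suc_eq simp del: of_nat_mult)
  qed auto
  with that show thesis by blast
qed

text \<open>Collinearity is expressed by vanishing 2 x 2 minors, so zero vectors are covered as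
  well. This is the only form in which the rationality hypothesis enters the measure
  estimates.\<close>

definition small_errors_collinear :: "nat \<Rightarrow> nat \<Rightarrow> (nat \<Rightarrow> nat \<Rightarrow> real) \<Rightarrow> real \<Rightarrow> bool" where
  "small_errors_collinear k l A \<kappa> \<longleftrightarrow>
    (\<forall>Q\<ge>1. \<forall>q p q' p'.
      (\<forall>j<l. \<bar>real_of_int (q j)\<bar> \<le> Q) \<longrightarrow> max_norm k (approx_error l A q p) < \<kappa> / Q \<longrightarrow>
      (\<forall>j<l. \<bar>real_of_int (q' j)\<bar> \<le> Q) \<longrightarrow> max_norm k (approx_error l A q' p') < \<kappa> / Q \<longrightarrow>
      (\<forall>i<k. \<forall>j<k. approx_error l A q p i * approx_error l A q' p' j
                  = approx_error l A q p j * approx_error l A q' p' i))"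

text \<open>With row \<open>i\<close> equal to \<open>r i\<close> times row \<open>i0\<close>, the
  contribution of \<open>A\<close> cancels in \<open>v i - r i * v i0\<close>, leaving an integer
  combination of 1 and \<open>r i\<close>. This has denominator dividing \<open>N\<close> and is
  smaller than \<open>1 / N\<close>, so it vanishes: \<open>v\<close> is a multiple of the fixed
  vector \<open>r\<close>.\<close>

lemma small_errors_collinear_rows:
  assumes "rows_rational_multiples k l A"
  obtains \<kappa> where "0 < \<kappa>" "\<kappa> \<le> 1" "small_errors_collinear k l A \<kappa>"
proof -
  from assms obtain i0 r where i0: "i0 < k" and r: "\<And>i. i < k \<Longrightarrow> r i \<in> \<rat>"
    and A: "\<And>i j. i < k \<Longrightarrow> j < l \<Longrightarrow> A i j = r i * A i0 j"
    unfolding rows_rational_multiples_def by metis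
  obtain N :: nat where N: "N > 0" "\<And>i. i < k \<Longrightarrow> r i * real N \<in> \<int>"
    using common_denominator[of k r] r by blast
  define D where "D = 1 + (\<Sum>i<k. \<bar>r i\<bar>)"
  have D1: "D \<ge> 1" by (simp add: D_def sum_nonneg)
  have rD: "1 + \<bar>r i\<bar> \<le> D" if "i < k" for i
    unfolding D_def using that member_le_sum[of i "{..<k}" "\<lambda>i. \<bar>r i\<bar>"] by simp
  \<comment> \<open>\<open>D\<close> bounds every \<open>1 + \<bar>r i\<bar>\<close>, so
    \<open>v i - r i * v i0\<close> stays below \<open>\<kappa> * D = 1 / N\<close>.\<close>
  define \<kappa> where "\<kappa> = 1 / (real N * D)"
  have ND: "real N * D \<ge> 1" using N(1) D1 mult_mono[of 1 "real N" 1 D] by simp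
  have proportional: "approx_error l A q p i = r i * approx_error l A q p i0"
    if Q: "Q \<ge> 1" and small: "max_norm k (approx_error l A q p) < \<kappa> / Q" and i: "i < k" for Q q p i
  proof -
    define v where "v = approx_error l A q p"
    have "\<kappa> / Q \<le> \<kappa> / 1"
      using Q ND by (intro divide_left_mono) (auto simp: \<kappa>_def)
    then have v: "\<bar>v j\<bar> < \<kappa>" if "j < k" for j
      using small abs_le_max_norm[OF that, of v] by (simp add: v_def)
    have diff: "v i - r i * v i0 = of_int (p i) - r i * of_int (p i0)"
    proof -
      have "(\<Sum>j<l. A i j * of_int (q j)) = r i * (\<Sum>j<l. A i0 j * of_int (q j))"
        unfolding sum_distrib_left using A[OF i] by (intro sum.cong) (auto simp only: lessThan_iff mult_ac)
      then show ?thesis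
        by (simp add: v_def approx_error_def distrib_left)
    qed
    have "(v i - r i * v i0) * real N = of_int (p i * int N) - (r i * real N) * of_int (p i0)"
      unfolding diff by (simp add: algebra_simps)
    also have "\<dots> \<in> \<int>" using N(2)[OF i] by (intro Ints_diff Ints_of_int Ints_mult[OF _ Ints_of_int])
    finally have int: "(v i - r i * v i0) * real N \<in> \<int>" .
    have "\<bar>v i - r i * v i0\<bar> \<le> \<bar>v i\<bar> + \<bar>r i\<bar> * \<bar>v i0\<bar>"
      by (metis abs_mult abs_triangle_ineq4)
    also have "\<dots> < \<kappa> + \<bar>r i\<bar> * \<kappa>"
      using v[OF i] v[OF i0] by (intro add_less_le_mono mult_left_mono) auto
    also have "\<dots> = \<kappa> * (1 + \<bar>r i\<bar>)" by (simp add: algebra_simps)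
    also have "\<dots> \<le> \<kappa> * D" using rD[OF i] ND by (intro mult_left_mono) (auto simp: \<kappa>_def)
    also have "\<dots> = 1 / real N" using D1 by (simp add: \<kappa>_def)
    finally have "\<bar>(v i - r i * v i0) * real N\<bar> < 1"
      using N(1) by (simp only: abs_mult abs_of_nat pos_less_divide_eq of_nat_0_less_iff)
    from Ints_abs_less_1[OF int this] N(1) show ?thesis by (simp add: v_def)
  qed
  have "small_errors_collinear k l A \<kappa>"
    unfolding small_errors_collinear_def
  proof (intro allI impI)
    fix Q q p q' p' i j
    assume "(1::real) \<le> Q" "max_norm k (approx_error l A q p) < \<kappa> / Q"
      "max_norm k (approx_error l A q' p') < \<kappa> / Q" "i < k" "j < k"
    then have "approx_error l A q p i = r i * approx_error l A q p i0"
      "approx_error l A q p j = r j * approx_error l A q p i0"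
      "approx_error l A q' p' i = r i * approx_error l A q' p' i0"
      "approx_error l A q' p' j = r j * approx_error l A q' p' i0"
      by (blast intro: proportional)+
    then show "approx_error l A q p i * approx_error l A q' p' j
        = approx_error l A q p j * approx_error l A q' p' i"
      by (simp only: mult_ac)
  qed
  moreover have "0 < \<kappa>" "\<kappa> \<le> 1" using ND by (auto simp: \<kappa>_def)
  ultimately show thesis using that by blast
qed

text \<open>Modulo integers every error is a multiple \<open>t q\<close> of the one column
  \<open>j0\<close>. This column cancels in \<open>t q * w i - t q' * v i\<close>, and what remains
  has denominator dividing \<open>N\<close>. Since \<open>t\<close> is at most \<open>D * Q\<close>
  and the errors are below \<open>\<kappa> / Q\<close>, it vanishes.\<close>

lemma small_errors_collinear_columns:
  assumes "columns_rational_multiples k l A"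
  obtains \<kappa> where "0 < \<kappa>" "\<kappa> \<le> 1" "small_errors_collinear k l A \<kappa>"
proof -
  from assms obtain j0 r where r: "\<And>j. j < l \<Longrightarrow> r j \<in> \<rat>"
    and A: "\<And>i j. i < k \<Longrightarrow> j < l \<Longrightarrow> A i j = r j * A i j0"
    unfolding columns_rational_multiples_def by metis
  obtain N :: nat where N: "N > 0" "\<And>j. j < l \<Longrightarrow> r j * real N \<in> \<int>"
    using common_denominator[of l r] r by blast
  define D where "D = 1 + (\<Sum>j<l. \<bar>r j\<bar>)"
  have D1: "D \<ge> 1" by (simp add: D_def sum_nonneg)
  \<comment> \<open>The factor 2 accounts for the two terms \<open>t q * w i\<close> and
    \<open>t q' * v i\<close>, each below \<open>D * \<kappa> = 1 / (2 * N)\<close>.\<close>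
  define \<kappa> where "\<kappa> = 1 / (2 * real N * D)"
  have ND: "real N * D \<ge> 1" using N(1) D1 mult_mono[of 1 "real N" 1 D] by simp
  have \<kappa>: "0 < \<kappa>" "\<kappa> \<le> 1"
    using ND by (simp_all add: \<kappa>_def mult.assoc)
  define t where "t q = (\<Sum>j<l. r j * real_of_int (q j))" for q :: "nat \<Rightarrow> int"
  have err: "approx_error l A q p i = t q * A i j0 + of_int (p i)" if "i < k" for q p i
  proof -
    have "(\<Sum>j<l. A i j * of_int (q j)) = (\<Sum>j<l. r j * of_int (q j) * A i j0)"
      using A[OF that] by (intro sum.cong) (auto simp only: lessThan_iff mult_ac)
    then show ?thesis
      by (simp add: approx_error_def t_def sum_distrib_right)
  qed
  have tN: "t q * real N \<in> \<int>" for q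
  proof -
    have "t q * real N = (\<Sum>j<l. (r j * real N) * of_int (q j))"
      unfolding t_def sum_distrib_right by (intro sum.cong) simp_all
    also have "\<dots> \<in> \<int>" using N(2) by (intro Ints_sum Ints_mult[OF _ Ints_of_int]) blast
    finally show ?thesis .
  qed
  have tD: "\<bar>t q\<bar> \<le> D * Q" if "Q \<ge> 1" "\<forall>j<l. \<bar>real_of_int (q j)\<bar> \<le> Q" for q Q
  proof -
    have "\<bar>t q\<bar> \<le> (\<Sum>j<l. \<bar>r j\<bar> * Q)"
      unfolding t_def using that
      by (intro order.trans[OF sum_abs] sum_mono) (auto simp: abs_mult intro!: mult_left_mono)
    also have "\<dots> \<le> D * Q" using that by (simp add: D_def algebra_simps sum_distrib_left)
    finally show ?thesis .
  qed
  have "small_errors_collinear k l A \<kappa>"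
    unfolding small_errors_collinear_def
  proof (intro allI impI)
    fix Q q p q' p' i j
    assume Q: "(1::real) \<le> Q"
      and q: "\<forall>j<l. \<bar>real_of_int (q j)\<bar> \<le> Q" "\<forall>j<l. \<bar>real_of_int (q' j)\<bar> \<le> Q"
      and small: "max_norm k (approx_error l A q p) < \<kappa> / Q"
        "max_norm k (approx_error l A q' p') < \<kappa> / Q"
      and ij: "i < k" "j < k"
    define v where "v = approx_error l A q p"
    define w where "w = approx_error l A q' p'"
    have vw: "\<bar>v i\<bar> < \<kappa> / Q" "\<bar>w i\<bar> < \<kappa> / Q" if "i < k" for i
      using small that by (auto simp: max_norm_less_iff v_def w_def)
    have eq: "t q * w i = t q' * v i" if i: "i < k" for i
    proof -
      have "(t q * w i - t q' * v i) * real N = (t q * real N) * of_int (p' i) - (t q' * real N) * of_int (p i)"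
        using i by (simp add: v_def w_def err algebra_simps)
      also have "\<dots> \<in> \<int>" using tN by (intro Ints_diff Ints_mult[OF _ Ints_of_int])
      finally have int: "(t q * w i - t q' * v i) * real N \<in> \<int>" .
      have "\<bar>t q * w i - t q' * v i\<bar> \<le> \<bar>t q\<bar> * \<bar>w i\<bar> + \<bar>t q'\<bar> * \<bar>v i\<bar>"
        by (metis abs_mult abs_triangle_ineq4)
      also have "\<dots> \<le> D * Q * \<bar>w i\<bar> + D * Q * \<bar>v i\<bar>"
        using tD Q q by (intro add_mono mult_right_mono) auto
      also have "\<dots> < D * Q * (\<kappa> / Q) + D * Q * (\<kappa> / Q)"
        using vw[OF i] D1 Q by (intro add_strict_mono mult_strict_left_mono) auto
      also have "\<dots> = 1 / real N" using D1 Q N(1) by (simp add: \<kappa>_def field_simps)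
      finally have "\<bar>(t q * w i - t q' * v i) * real N\<bar> < 1"
        using N(1) by (simp only: abs_mult abs_of_nat pos_less_divide_eq of_nat_0_less_iff)
      from Ints_abs_less_1[OF int this] N(1) show ?thesis by simp
    qed
    \<comment> \<open>Without the column term an error is the integer vector \<open>p\<close>, and
      an integer below 1 in absolute value is 0.\<close>
    have "\<kappa> / Q \<le> 1 / 1" using Q \<kappa> by (intro frac_le) auto
    then have zero: "v i = 0" if "i < k" "t q = 0" for i
      using that vw(1)[of i] by (intro Ints_abs_less_1) (auto simp: v_def err)
    show "approx_error l A q p i * approx_error l A q' p' j
        = approx_error l A q p j * approx_error l A q' p' i"
    proof (cases "t q = 0")
      case True
      with zero ij show ?thesis by (simp add: v_def)
    next
      case False
      have "t q * (v i * w j) = v i * (t q * w j)" by (simp only: mult_ac)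
      also have "\<dots> = v j * (t q * w i)" by (simp only: eq ij mult_ac)
      also have "\<dots> = t q * (v j * w i)" by (simp only: mult_ac)
      finally have "t q * (v i * w j) = t q * (v j * w i)" .
      with False show ?thesis by (simp add: v_def w_def)
    qed
  qed
  with \<kappa> show thesis using that by blast
qed

section \<open>Measure of slabs in cubes\<close>

abbreviation lebesgue_space :: "nat \<Rightarrow> (nat \<Rightarrow> real) measure" where
  "lebesgue_space s \<equiv> \<Pi>\<^sub>M i\<in>{..<s}. lborel"

abbreviation cube :: "nat \<Rightarrow> real \<Rightarrow> (nat \<Rightarrow> real) set" where
  "cube s R \<equiv> {..<s} \<rightarrow>\<^sub>E {-R..R}"

lemma product_sigma_finite_lborel: "product_sigma_finite (\<lambda>_. lborel :: real measure)"
  by standard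

lemma sets_cube: "cube s R \<in> sets (lebesgue_space s)"
  by (rule sets_PiM_I_finite) auto

lemma emeasure_cube:
  assumes "finite I" "0 \<le> R"
  shows "emeasure (\<Pi>\<^sub>M i\<in>I. lborel) (I \<rightarrow>\<^sub>E {-R..R}) = ennreal ((2 * R) ^ card I)"
  using assms by (subst product_sigma_finite.emeasure_PiM[OF product_sigma_finite_lborel])
    (auto simp: ennreal_power)

lemma measurable_affine_form: "affine_form s v \<in> borel_measurable (lebesgue_space s)"
proof -
  have "(\<lambda>x. x i) \<in> borel_measurable (lebesgue_space s)" if "i < s" for i
    using measurable_component_singleton[of i "{..<s}" "\<lambda>_. lborel :: real measure"] that by simp
  then show ?thesis
    unfolding affine_form_def by (intro borel_measurable_add borel_measurable_sum borel_measurable_times) auto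
qed

lemma sets_slab: "{x \<in> cube s R. \<bar>affine_form s v x\<bar> < \<eta>} \<in> sets (lebesgue_space s)"
proof -
  have "{x \<in> cube s R. \<bar>affine_form s v x\<bar> < \<eta>}
      = cube s R \<inter> {x \<in> space (lebesgue_space s). \<bar>affine_form s v x\<bar> < \<eta>}"
    by (auto simp: space_PiM)
  then show ?thesis
    using sets_cube borel_measurable_less[of "\<lambda>x. \<bar>affine_form s v x\<bar>" "lebesgue_space s" "\<lambda>_. \<eta>"]
      measurable_affine_form[of s v] by (auto intro!: sets.Int borel_measurable_abs)
qed

text \<open>Fubini in coordinate \<open>i\<close>: once the others are fixed, \<open>x i\<close> is
  confined to an interval of length \<open>2 * \<eta> / \<bar>v (Suc i)\<bar>\<close>, while the
  others range over a cube of dimension \<open>s - 1\<close>.\<close>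

lemma emeasure_slab_coefficient:
  assumes i: "i < s" and g: "v (Suc i) \<noteq> 0" and R: "0 \<le> R" and \<eta>: "0 < \<eta>"
  shows "emeasure (lebesgue_space s) {x \<in> cube s R. \<bar>affine_form s v x\<bar> < \<eta>}
    \<le> ennreal ((2 * R) ^ (s - 1) * (2 * \<eta> / \<bar>v (Suc i)\<bar>))"
proof -
  interpret product_sigma_finite "\<lambda>_ :: nat. lborel :: real measure"
    by (rule product_sigma_finite_lborel)
  define I where "I = {..<s} - {i}"
  have I: "finite I" "i \<notin> I" "insert i I = {..<s}" "card I = s - 1"
    using i by (auto simp: I_def)
  define S where "S = {x \<in> cube s R. \<bar>affine_form s v x\<bar> < \<eta>}"
  define b where "b x = v 0 + (\<Sum>j\<in>I. v (Suc j) * x j)" for x :: "nat \<Rightarrow> real"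
  define J where "J x = {- b x / v (Suc i) - \<eta> / \<bar>v (Suc i)\<bar> .. - b x / v (Suc i) + \<eta> / \<bar>v (Suc i)\<bar>}" for x
  have S: "S \<in> sets (PiM (insert i I) (\<lambda>_. lborel))"
    unfolding I(3) S_def by (rule sets_slab)
  have form: "affine_form s v (x(i := y)) = b x + v (Suc i) * y" for x y
  proof -
    have "(\<Sum>j<s. v (Suc j) * (x(i := y)) j) = v (Suc i) * y + (\<Sum>j\<in>I. v (Suc j) * (x(i := y)) j)"
      using i by (simp add: I_def sum.remove)
    also have "(\<Sum>j\<in>I. v (Suc j) * (x(i := y)) j) = (\<Sum>j\<in>I. v (Suc j) * x j)"
      using I(2) by (intro sum.cong) auto
    finally show ?thesis by (simp add: affine_form_def b_def)
  qed
  have ind: "(indicator S (x(i := y)) :: ennreal) \<le> indicator (I \<rightarrow>\<^sub>E {-R..R}) x * indicator (J x) y"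
    if x: "x \<in> space (\<Pi>\<^sub>M i\<in>I. lborel)" for x y
  proof (cases "x(i := y) \<in> S")
    case True
    have "x \<in> I \<rightarrow>\<^sub>E {-R..R}"
    proof (rule PiE_I)
      fix j assume "j \<in> I"
      then have "j \<in> {..<s}" "j \<noteq> i" by (auto simp: I_def)
      with True show "x j \<in> {-R..R}"
        by (auto simp: S_def PiE_iff split: if_splits)
    qed (use x in \<open>auto simp: space_PiM PiE_iff extensional_def\<close>)
    moreover have "y \<in> J x"
    proof -
      have "\<bar>b x + v (Suc i) * y\<bar> < \<eta>" using True by (simp add: S_def form)
      moreover have "b x + v (Suc i) * y = v (Suc i) * (y - (- b x / v (Suc i)))"
        using g by (simp add: algebra_simps)
      ultimately have "\<bar>y - (- b x / v (Suc i))\<bar> < \<eta> / \<bar>v (Suc i)\<bar>"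
        using g by (simp add: abs_mult pos_less_divide_eq mult.commute)
      then show ?thesis by (simp only: J_def atLeastAtMost_iff) linarith
    qed
    ultimately show ?thesis by (simp add: indicator_def)
  qed simp
  have "emeasure (lebesgue_space s) S = (\<integral>\<^sup>+x. indicator S x \<partial>(\<Pi>\<^sub>M j\<in>insert i I. lborel))"
    using S I(3) by simp
  also have "\<dots> = (\<integral>\<^sup>+x. \<integral>\<^sup>+y. indicator S (x(i := y)) \<partial>lborel \<partial>(\<Pi>\<^sub>M j\<in>I. lborel))"
    using S I by (intro product_nn_integral_insert) auto
  also have "\<dots> \<le> (\<integral>\<^sup>+x. \<integral>\<^sup>+y. indicator (I \<rightarrow>\<^sub>E {-R..R}) x * indicator (J x) y \<partial>lborel \<partial>(\<Pi>\<^sub>M j\<in>I. lborel))"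
    by (intro nn_integral_mono ind)
  also have "\<dots> = (\<integral>\<^sup>+x. ennreal (2 * \<eta> / \<bar>v (Suc i)\<bar>) * indicator (I \<rightarrow>\<^sub>E {-R..R}) x \<partial>(\<Pi>\<^sub>M j\<in>I. lborel))"
  proof (rule nn_integral_cong)
    fix x
    have "(\<integral>\<^sup>+y. indicator (I \<rightarrow>\<^sub>E {-R..R}) x * indicator (J x) y \<partial>lborel)
      = indicator (I \<rightarrow>\<^sub>E {-R..R}) x * emeasure lborel (J x)"
      by (rule nn_integral_cmult_indicator) (simp add: J_def)
    also have "emeasure lborel (J x) = ennreal (2 * \<eta> / \<bar>v (Suc i)\<bar>)"
      using \<eta> by (simp add: J_def)
    finally show "(\<integral>\<^sup>+y. indicator (I \<rightarrow>\<^sub>E {-R..R}) x * indicator (J x) y \<partial>lborel)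
      = ennreal (2 * \<eta> / \<bar>v (Suc i)\<bar>) * indicator (I \<rightarrow>\<^sub>E {-R..R}) x"
      by (simp add: mult.commute)
  qed
  also have "\<dots> = ennreal (2 * \<eta> / \<bar>v (Suc i)\<bar>) * emeasure (\<Pi>\<^sub>M j\<in>I. lborel) (I \<rightarrow>\<^sub>E {-R..R})"
    using I by (intro nn_integral_cmult_indicator sets_PiM_I_finite) auto
  also have "\<dots> = ennreal ((2 * R) ^ (s - 1) * (2 * \<eta> / \<bar>v (Suc i)\<bar>))"
    using I \<eta> R by (simp add: emeasure_cube mult.commute ennreal_mult[symmetric])
  finally show ?thesis by (simp add: S_def)
qed

lemma abs_linear_part_le:
  assumes "x \<in> cube s R" "0 \<le> R" "\<And>i. i < s \<Longrightarrow> \<bar>v (Suc i)\<bar> \<le> G"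
  shows "\<bar>\<Sum>i<s. v (Suc i) * x i\<bar> \<le> real s * R * G"
proof -
  have "\<bar>v (Suc i) * x i\<bar> \<le> G * R" if "i < s" for i
  proof -
    have "\<bar>x i\<bar> \<le> R" using PiE_mem[OF assms(1), of i] that by auto
    moreover have "0 \<le> G" using assms(3)[OF that] by linarith
    ultimately show ?thesis unfolding abs_mult using assms that by (intro mult_mono) auto
  qed
  then have "\<bar>\<Sum>i<s. v (Suc i) * x i\<bar> \<le> (\<Sum>i<s. G * R)"
    by (intro order.trans[OF sum_abs] sum_mono) auto
  then show ?thesis by (simp add: mult_ac)
qed

text \<open>Either the largest gradient coefficient is comparable with the norm of \<open>v\<close>
  and the one-coordinate bound applies to it, or the constant term dominates. Then the form is at
  least half the norm on the whole cube, so the slab is empty unless \<open>\<eta>\<close> is so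
  large that the measure of the cube is a sufficient bound.\<close>

lemma emeasure_slab:
  assumes s: "1 \<le> s" and R: "1 \<le> R" and \<eta>: "0 < \<eta>" and pos: "0 < max_norm (s + 1) v"
  shows "emeasure (lebesgue_space s) {x \<in> cube s R. \<bar>affine_form s v x\<bar> < \<eta>}
    \<le> ennreal (2 * real s * (2 * R) ^ s * \<eta> / max_norm (s + 1) v)"
proof -
  define M where "M = max_norm (s + 1) v"
  define G where "G = max_norm s (\<lambda>i. v (Suc i))"
  have G: "\<bar>v (Suc i)\<bar> \<le> G" if "i < s" for i
    using abs_le_max_norm[OF that, of "\<lambda>i. v (Suc i)"] by (simp add: G_def)
  have G0: "0 \<le> G" by (simp add: G_def max_norm_nonneg)
  have sR: "1 \<le> real s * R" using s R mult_mono[of 1 "real s" 1 R] by simp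
  have M: "0 < M" using pos by (simp add: M_def)
  have pow: "(2 * R) ^ s = 2 * R * (2 * R) ^ (s - 1)"
    using s by (cases s) auto
  show ?thesis
  \<comment> \<open>The linear part is at most \<open>real s * R * G\<close> on the cube, so in the
    negative case the constant term exceeds twice the linear part.\<close>
  proof (cases "\<bar>v 0\<bar> \<le> 2 * real s * R * G")
    case True
    have "G \<le> 2 * (real s * R) * G"
      using sR G0 mult_right_mono[of 1 "2 * (real s * R)" G] by simp
    then have "\<bar>v i\<bar> \<le> 2 * real s * R * G" if "i < s + 1" for i
      using True that G[of "i - 1"] by (cases i) (auto simp: mult.assoc)
    then have MG: "M \<le> 2 * real s * R * G"
      using G0 sR R by (auto simp: M_def max_norm_le_iff)
    with M have "0 < G" using G0 by (cases "G = 0") auto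
    then obtain i where i: "i < s" "\<bar>v (Suc i)\<bar> = G"
      using max_norm_attained[of s "\<lambda>i. v (Suc i)"] unfolding G_def by metis
    have "2 * \<eta> / G \<le> 2 * \<eta> * (2 * real s * R) / M"
      using MG M \<open>0 < G\<close> \<eta> by (simp add: field_simps)
    then have "(2 * R) ^ (s - 1) * (2 * \<eta> / G) \<le> (2 * R) ^ (s - 1) * (2 * \<eta> * (2 * real s * R) / M)"
      using R by (intro mult_left_mono) auto
    also have "\<dots> = 2 * real s * (2 * R) ^ s * \<eta> / M"
      by (simp only: pow) (simp add: mult_ac)
    finally show ?thesis
      using emeasure_slab_coefficient[of i s v R \<eta>] i \<open>0 < G\<close> R \<eta>
      by (auto simp: M_def intro: order.trans ennreal_leI)
  next
    case False
    have v0: "\<bar>v 0\<bar> = M"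
    proof (rule antisym)
      show "\<bar>v 0\<bar> \<le> M" unfolding M_def by (rule abs_le_max_norm) simp
      have "G \<le> 2 * (real s * R) * G"
        using sR G0 mult_right_mono[of 1 "2 * (real s * R)" G] by simp
      then have "\<bar>v i\<bar> \<le> \<bar>v 0\<bar>" if "i < s + 1" for i
        using False that G[of "i - 1"] by (cases i) (auto simp: mult.assoc)
      then show "M \<le> \<bar>v 0\<bar>" by (auto simp: M_def max_norm_le_iff)
    qed
    show ?thesis
    proof (cases "{x \<in> cube s R. \<bar>affine_form s v x\<bar> < \<eta>} = {}")
      case True
      then show ?thesis by (simp only: emeasure_empty zero_le)
    next
      case nonempty: False
      then obtain x where x: "x \<in> cube s R" "\<bar>affine_form s v x\<bar> < \<eta>" by auto
      have "\<bar>\<Sum>i<s. v (Suc i) * x i\<bar> \<le> real s * R * G"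
        using abs_linear_part_le[OF x(1)] R G by auto
      with x(2) False have "M < 2 * \<eta>"
        using v0 unfolding affine_form_def by linarith
      then have "1 \<le> 2 * \<eta> / M" using M by simp
      moreover have "1 \<le> real s" using s by simp
      ultimately have "1 * 1 \<le> real s * (2 * \<eta> / M)" by (intro mult_mono) auto
      then have "(2 * R) ^ s * 1 \<le> (2 * R) ^ s * (real s * (2 * \<eta> / M))"
        using R by (intro mult_left_mono) auto
      then have *: "(2 * R) ^ s \<le> 2 * real s * (2 * R) ^ s * \<eta> / M"
        by (simp add: mult_ac)
      have "emeasure (lebesgue_space s) {x \<in> cube s R. \<bar>affine_form s v x\<bar> < \<eta>}
          \<le> emeasure (lebesgue_space s) (cube s R)"
        by (rule emeasure_mono) (auto simp: sets_cube)
      also have "\<dots> = ennreal ((2 * R) ^ s)" using R by (simp add: emeasure_cube)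
      also have "\<dots> \<le> ennreal (2 * real s * (2 * R) ^ s * \<eta> / M)" using * by (rule ennreal_leI)
      finally show ?thesis by (simp add: M_def)
    qed
  qed
qed

section \<open>Counting integer shifts and vectors\<close>

lemma finite_card_ints_near:
  fixes b W :: real
  assumes "0 \<le> W"
  shows "finite {k :: int. \<bar>b + of_int k\<bar> \<le> W}" "real (card {k :: int. \<bar>b + of_int k\<bar> \<le> W}) \<le> 2 * W + 1"
proof -
  have eq: "{k :: int. \<bar>b + of_int k\<bar> \<le> W} = {\<lceil>- W - b\<rceil>..\<lfloor>W - b\<rfloor>}"
    by (auto simp: abs_le_iff ceiling_le_iff le_floor_iff)
  show "finite {k :: int. \<bar>b + of_int k\<bar> \<le> W}" unfolding eq by simp
  show "real (card {k :: int. \<bar>b + of_int k\<bar> \<le> W}) \<le> 2 * W + 1"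
    unfolding eq using assms by (simp add: of_nat_nat) linarith
qed

text \<open>Only the constant term moves, in unit steps. At most \<open>2 * s * R * G + 3\<close> of
  the slabs meet the cube, where \<open>G\<close> is the norm of the gradient, and each counted slab
  has measure at most \<open>C * \<eta> / max G \<tau>\<close>, so the product stays bounded as
  \<open>G\<close> grows. \<open>E\<close> is the resulting finite union.\<close>

lemma emeasure_slabs_shifted:
  assumes s: "1 \<le> s" and R: "1 \<le> R" and \<eta>: "0 < \<eta>" "\<eta> \<le> 1" and \<tau>: "0 < \<tau>"
  shows "\<exists>E\<in>sets (lebesgue_space s).
    {x \<in> cube s R. \<exists>k :: int. \<bar>affine_form s (v(0 := b + of_int k)) x\<bar> < \<eta>
        \<and> \<tau> \<le> max_norm (s + 1) (v(0 := b + of_int k))} \<subseteq> E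
    \<and> emeasure (lebesgue_space s) E \<le> ennreal (2 * real s * (2 * R) ^ s * (2 * real s * R + 3 / \<tau>) * \<eta>)"
proof -
  define w where "w k = v(0 := b + of_int k)" for k :: int
  define G where "G = max_norm s (\<lambda>i. v (Suc i))"
  define W where "W = real s * R * G + \<eta>"
  define T where "T = {k :: int. \<bar>b + of_int k\<bar> \<le> W}"
  define T' where "T' = {k \<in> T. \<tau> \<le> max_norm (s + 1) (w k)}"
  define C where "C = 2 * real s * (2 * R) ^ s"
  define E where "E = (\<Union>k\<in>T'. {x \<in> cube s R. \<bar>affine_form s (w k) x\<bar> < \<eta>})"
  have G: "\<bar>v (Suc i)\<bar> \<le> G" if "i < s" for i
    using abs_le_max_norm[OF that, of "\<lambda>i. v (Suc i)"] by (simp add: G_def)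
  have G0: "0 \<le> G" by (simp add: G_def max_norm_nonneg)
  have C0: "0 \<le> C" using R by (simp add: C_def)
  have W0: "0 \<le> W" using R G0 \<eta> by (simp add: W_def)
  have T: "finite T" "real (card T) \<le> 2 * W + 1"
    using finite_card_ints_near[OF W0] by (auto simp: T_def)
  have T': "finite T'" "card T' \<le> card T" using T by (auto simp: T'_def intro: card_mono)
  have "\<exists>k\<in>T'. \<bar>affine_form s (w k) x\<bar> < \<eta>"
    if x: "x \<in> cube s R" and k: "\<bar>affine_form s (w k) x\<bar> < \<eta>" "\<tau> \<le> max_norm (s + 1) (w k)" for x k
  proof -
    have "\<bar>\<Sum>i<s. w k (Suc i) * x i\<bar> \<le> real s * R * G"
      using abs_linear_part_le[OF x] R G by (auto simp: w_def)
    then have "\<bar>w k 0\<bar> \<le> W"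
      using k(1) unfolding W_def affine_form_def by linarith
    with k show ?thesis by (auto simp: T'_def T_def w_def)
  qed
  then have sub: "{x \<in> cube s R. \<exists>k :: int. \<bar>affine_form s (w k) x\<bar> < \<eta>
        \<and> \<tau> \<le> max_norm (s + 1) (w k)} \<subseteq> E"
    by (auto simp: E_def)
  have each: "emeasure (lebesgue_space s) {x \<in> cube s R. \<bar>affine_form s (w k) x\<bar> < \<eta>}
      \<le> ennreal (C * \<eta> / max G \<tau>)" if "k \<in> T'" for k
  proof -
    define M where "M = max_norm (s + 1) (w k)"
    have "\<bar>v (Suc i)\<bar> \<le> M" if "i < s" for i
      using abs_le_max_norm[of "Suc i" "s + 1" "w k"] that by (simp add: M_def w_def)
    then have "G \<le> M" by (auto simp: G_def max_norm_le_iff) (simp add: M_def max_norm_nonneg)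
    moreover have "\<tau> \<le> M" using that by (simp add: T'_def M_def)
    ultimately have le: "max G \<tau> \<le> M" and M: "0 < M" using \<tau> by auto
    have "emeasure (lebesgue_space s) {x \<in> cube s R. \<bar>affine_form s (w k) x\<bar> < \<eta>}
      \<le> ennreal (C * \<eta> / M)"
      using emeasure_slab[OF s R \<eta>(1), of "w k"] M by (simp add: M_def C_def)
    also have "\<dots> \<le> ennreal (C * \<eta> / max G \<tau>)"
      using le \<tau> C0 \<eta> by (intro ennreal_leI divide_left_mono) auto
    finally show ?thesis .
  qed
  have "emeasure (lebesgue_space s) E
      \<le> (\<Sum>k\<in>T'. emeasure (lebesgue_space s) {x \<in> cube s R. \<bar>affine_form s (w k) x\<bar> < \<eta>})"
    unfolding E_def using T' sets_slab by (intro emeasure_subadditive_finite) auto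
  also have "\<dots> \<le> (\<Sum>k\<in>T'. ennreal (C * \<eta> / max G \<tau>))"
    by (intro sum_mono each)
  also have "\<dots> = ennreal (real (card T') * (C * \<eta> / max G \<tau>))"
    using C0 \<eta> \<tau> by (subst ennreal_mult) (auto simp: ennreal_of_nat_eq_real_of_nat)
  also have "\<dots> \<le> ennreal (C * (2 * real s * R + 3 / \<tau>) * \<eta>)"
  proof (rule ennreal_leI)
    have "real (card T') \<le> 2 * real s * R * G + 3"
      using T T' \<eta> by (simp add: W_def)
    \<comment> \<open>The term growing with \<open>G\<close> is bounded through
      \<open>G \<le> max G \<tau>\<close>, the constant 3 through
      \<open>\<tau> \<le> max G \<tau>\<close>.\<close>
    also have "\<dots> \<le> (2 * real s * R + 3 / \<tau>) * max G \<tau>"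
    proof -
      have "2 * real s * R * G \<le> 2 * real s * R * max G \<tau>" using R by (intro mult_left_mono) auto
      moreover have "3 / \<tau> * \<tau> \<le> 3 / \<tau> * max G \<tau>" using \<tau> by (intro mult_left_mono) auto
      ultimately show ?thesis using \<tau> by (simp add: distrib_right)
    qed
    finally have "real (card T') * (C * \<eta> / max G \<tau>)
        \<le> (2 * real s * R + 3 / \<tau>) * max G \<tau> * (C * \<eta> / max G \<tau>)"
      using C0 \<eta> \<tau> by (intro mult_right_mono) auto
    also have "\<dots> = C * (2 * real s * R + 3 / \<tau>) * \<eta>"
      using \<tau> by simp
    finally show "real (card T') * (C * \<eta> / max G \<tau>) \<le> C * (2 * real s * R + 3 / \<tau>) * \<eta>" .
  qed
  finally have "emeasure (lebesgue_space s) E \<le> ennreal (C * (2 * real s * R + 3 / \<tau>) * \<eta>)" .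
  moreover have "E \<in> sets (lebesgue_space s)"
    unfolding E_def using T' sets_slab by (intro sets.finite_UN) auto
  ultimately show ?thesis
    using sub by (auto simp: C_def w_def)
qed

text \<open>Once the other coordinates are fixed, \<open>q 0\<close> lies in an open interval of
  length 2 and so takes at most two values. In the application \<open>h q + of_int (q 0)\<close> is
  the first gradient coefficient of a form.\<close>

lemma card_small_first_gradient:
  fixes h :: "(nat \<Rightarrow> int) \<Rightarrow> real"
  assumes n: "1 \<le> n" and h: "\<And>q a. h (q(0 := a)) = h q"
  shows "card {q \<in> {..<n} \<rightarrow>\<^sub>E {-int N..int N}. \<bar>h q + of_int (q 0)\<bar> < 1} \<le> 2 * (2 * N + 1) ^ (n - 1)"
proof -
  define P where "P = {1..<n} \<rightarrow>\<^sub>E {-int N..int N}"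
  have finP: "finite P" unfolding P_def by (intro finite_PiE) auto
  have cardP: "card P = (2 * N + 1) ^ (n - 1)"
    unfolding P_def by (subst card_PiE) (auto simp: nat_add_distrib nat_mult_distrib)
  \<comment> \<open>These are the only candidates for an integer at distance less than 1 from
    \<open>- h q\<close>.\<close>
  let ?f = "\<lambda>q. q(0 := \<lfloor>- h q\<rfloor>)" and ?g = "\<lambda>q. q(0 := \<lfloor>- h q\<rfloor> + 1)"
  have "{q \<in> {..<n} \<rightarrow>\<^sub>E {-int N..int N}. \<bar>h q + of_int (q 0)\<bar> < 1} \<subseteq> ?f ` P \<union> ?g ` P"
  proof
    fix q assume q: "q \<in> {q \<in> {..<n} \<rightarrow>\<^sub>E {-int N..int N}. \<bar>h q + of_int (q 0)\<bar> < 1}"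
    define p where "p = q(0 := undefined)"
    have "p \<in> P" using q n by (auto simp: P_def p_def PiE_iff extensional_def)
    have hp: "h p = h q" by (simp add: p_def h)
    have "q 0 = \<lfloor>- h q\<rfloor> \<or> q 0 = \<lfloor>- h q\<rfloor> + 1" using q by simp linarith
    moreover have "q = p(0 := q 0)" by (simp add: p_def)
    ultimately have "q = ?f p \<or> q = ?g p" by (metis hp)
    with \<open>p \<in> P\<close> show "q \<in> ?f ` P \<union> ?g ` P" by blast
  qed
  then have "card {q \<in> {..<n} \<rightarrow>\<^sub>E {-int N..int N}. \<bar>h q + of_int (q 0)\<bar> < 1} \<le> card (?f ` P \<union> ?g ` P)"
    using finP by (intro card_mono) auto
  also have "\<dots> \<le> card P + card P"
    using card_Un_le card_image_le[OF finP] by (meson add_mono order.trans)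
  finally show ?thesis by (simp add: cardP)
qed

section \<open>Measure estimates for approximable points\<close>

text \<open>The inequality of singularity at one scale. Letting \<open>q\<close> range over a finite
  set of extensional functions makes measurability easy; for integer entries the floor loses
  nothing.\<close>

definition approximable :: "nat \<Rightarrow> real \<Rightarrow> real \<Rightarrow> (nat \<Rightarrow> real) \<Rightarrow> bool" where
  "approximable n c Q y \<longleftrightarrow>
    (\<exists>q\<in>{..<n} \<rightarrow>\<^sub>E {-\<lfloor>Q\<rfloor>..\<lfloor>Q\<rfloor>}. \<exists>q0 :: int. (\<exists>i<n. q i \<noteq> 0) \<and>
      \<bar>(\<Sum>i<n. of_int (q i) * y i) + of_int q0\<bar> < c / Q ^ n)"

lemma eventually_approximable:
  assumes "singular_vector n y" "0 < c"
  shows "\<forall>\<^sub>F Q in at_top. approximable n c Q y"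
proof -
  from assms have "\<forall>\<^sub>F Q :: real in at_top. \<exists>(q :: nat \<Rightarrow> int) (q0 :: int). (\<exists>i<n. q i \<noteq> 0) \<and>
      \<bar>(\<Sum>i<n. of_int (q i) * y i) + of_int q0\<bar> < c / Q ^ n \<and> max_norm n (\<lambda>i. of_int (q i)) \<le> Q"
    by (simp add: singular_vector_def)
  then show ?thesis
  proof eventually_elim
    case (elim Q)
    then obtain q :: "nat \<Rightarrow> int" and q0 :: int where q: "\<exists>i<n. q i \<noteq> 0"
      "\<bar>(\<Sum>i<n. of_int (q i) * y i) + of_int q0\<bar> < c / Q ^ n" "max_norm n (\<lambda>i. of_int (q i)) \<le> Q"
      by blast
    have "q i \<in> {-\<lfloor>Q\<rfloor>..\<lfloor>Q\<rfloor>}" if "i < n" for i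
    proof -
      have "\<bar>real_of_int (q i)\<bar> \<le> Q" using q(3) that by (simp add: max_norm_le_iff)
      then show ?thesis by (simp add: abs_le_iff) linarith
    qed
    then have "restrict q {..<n} \<in> {..<n} \<rightarrow>\<^sub>E {-\<lfloor>Q\<rfloor>..\<lfloor>Q\<rfloor>}" by auto
    moreover have "(\<Sum>i<n. of_int (restrict q {..<n} i) * y i) = (\<Sum>i<n. of_int (q i) * y i)"
      by (intro sum.cong) auto
    ultimately show ?case
      unfolding approximable_def using q(1,2)
      by (intro bexI[of _ "restrict q {..<n}"] exI[of _ q0]) auto
  qed
qed

lemma pred_approximable:
  "Measurable.pred (\<Pi>\<^sub>M i\<in>{..<n}. (borel :: real measure)) (approximable n c Q)"
proof -
  have "(\<lambda>y. (\<Sum>i<n. of_int (q i) * y i) + of_int q0) \<in> borel_measurable (\<Pi>\<^sub>M i\<in>{..<n}. (borel :: real measure))"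
    for q :: "nat \<Rightarrow> int" and q0 :: int
    by (intro borel_measurable_add borel_measurable_sum borel_measurable_times measurable_component_singleton) auto
  note [measurable] = this
  have "finite ({..<n} \<rightarrow>\<^sub>E {-\<lfloor>Q\<rfloor>..\<lfloor>Q\<rfloor>})" by (intro finite_PiE) auto
  then show ?thesis
    unfolding approximable_def by (intro pred_intros_finite(4)) measurable
qed

text \<open>This puts the errors for varying \<open>q0\<close> into the shape
  \<open>v(0 := b + of_int k)\<close> of the estimate for shifted slabs.\<close>

lemma tail_error_shift:
  "tail_error s n A q k = (tail_error s n A q 0)(0 := (\<Sum>j<n - s. A 0 j * of_int (q (s + j))) + of_int k)"
  by (rule ext) (auto simp: approx_error_def split: nat.split)

text \<open>Proportional vectors have proportional forms, and the ratio is read off at a coordinate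
  where \<open>\<bar>v j\<bar>\<close> is maximal. Together with a lower bound on the norm of
  \<open>v\<close>, this places a slab of \<open>v\<close> inside a slab of
  \<open>w\<close>.\<close>

lemma collinear_form_bound:
  assumes "\<forall>i<s + 1. \<forall>j<s + 1. v i * w j = v j * w i" and "0 < max_norm (s + 1) v"
  shows "\<bar>affine_form s w x\<bar> * max_norm (s + 1) v \<le> max_norm (s + 1) w * \<bar>affine_form s v x\<bar>"
proof -
  obtain j where j: "j < s + 1" "\<bar>v j\<bar> = max_norm (s + 1) v"
    using max_norm_attained[OF assms(2)] by blast
  have vw: "w i * v j = w j * v i" if "i < s + 1" for i
    using assms(1) j that by (metis mult.commute)
  have "affine_form s w x * v j = w 0 * v j + (\<Sum>i<s. (w (Suc i) * v j) * x i)"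
    by (simp add: affine_form_def distrib_left distrib_right sum_distrib_left mult_ac)
  also have "\<dots> = w j * v 0 + (\<Sum>i<s. (w j * v (Suc i)) * x i)"
    using vw by (intro arg_cong2[of _ _ _ _ "(+)"] sum.cong) auto
  also have "\<dots> = w j * affine_form s v x"
    by (simp add: affine_form_def distrib_left sum_distrib_left mult_ac)
  finally have "\<bar>affine_form s w x\<bar> * \<bar>v j\<bar> = \<bar>w j\<bar> * \<bar>affine_form s v x\<bar>"
    by (metis abs_mult)
  then show ?thesis
    using j abs_le_max_norm[OF j(1), of w] by (simp add: mult_right_mono)
qed

text \<open>One slab \<open>L\<close> takes all errors of norm below \<open>\<kappa> / Q\<close>,
  and the sets \<open>E q\<close> take the rest. \<open>K\<close> is chosen before \<open>Q\<close>
  and \<open>\<epsilon>\<close>; the lower bound is assumed at the scale \<open>Q\<close> alone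
  because it will be available only along a sequence of scales.\<close>

lemma emeasure_approximable:
  assumes s: "1 \<le> s" "s < n" and R: "1 \<le> R" and \<kappa>: "0 < \<kappa>" "\<kappa> \<le> 1" and c: "0 < c"
    and coll: "small_errors_collinear (s + 1) (n - s) A \<kappa>"
  obtains K where
    "\<And>Q \<epsilon>. 1 \<le> Q \<Longrightarrow> 0 < \<epsilon> \<Longrightarrow> \<epsilon> \<le> 1 \<Longrightarrow>
      (\<And>q p. \<exists>j<n - s. q j \<noteq> 0 \<Longrightarrow> \<forall>j<n - s. \<bar>real_of_int (q j)\<bar> \<le> Q \<Longrightarrow>
        c / Q ^ n \<le> max_norm (s + 1) (approx_error (n - s) A q p)) \<Longrightarrow>
      emeasure (lebesgue_space s) {x \<in> cube s R. approximable n \<epsilon> Q (affine_param s n A x)}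
        \<le> ennreal (K * \<epsilon>)"
proof -
  define C where "C = 2 * real s * (2 * R) ^ s"
  \<comment> \<open>The summands belong to the slab \<open>L\<close>, to all vectors at threshold 1,
    and to the vectors in \<open>F1\<close> at threshold \<open>\<kappa> / Q\<close>. The powers of
    3 come from \<open>2 * N + 1 \<le> 3 * Q\<close>.\<close>
  define K where "K = C / c + 3 ^ n * C * (2 * real s * R + 3) + 2 * 3 ^ n * C * (2 * real s * R + 3 / \<kappa>)"
  have C0: "0 \<le> C" using R by (simp add: C_def)
  have "emeasure (lebesgue_space s) {x \<in> cube s R. approximable n \<epsilon> Q (affine_param s n A x)}
        \<le> ennreal (K * \<epsilon>)"
    if Q: "1 \<le> Q" and \<epsilon>: "0 < \<epsilon>" "\<epsilon> \<le> 1" and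
      lower: "\<And>q p. \<exists>j<n - s. q j \<noteq> 0 \<Longrightarrow> \<forall>j<n - s. \<bar>real_of_int (q j)\<bar> \<le> Q \<Longrightarrow>
        c / Q ^ n \<le> max_norm (s + 1) (approx_error (n - s) A q p)" for Q \<epsilon>
  proof -
    let ?\<mu> = "emeasure (lebesgue_space s)"
    define \<eta> where "\<eta> = \<epsilon> / Q ^ n"
    have Qn: "1 \<le> Q ^ n" using Q by (rule one_le_power)
    have \<eta>: "0 < \<eta>" "\<eta> \<le> 1" using \<epsilon> Qn by (auto simp: \<eta>_def)
    define N where "N = nat \<lfloor>Q\<rfloor>"
    have N: "int N = \<lfloor>Q\<rfloor>" "real N \<le> Q" using Q by (auto simp: N_def)
    define F where "F = {..<n} \<rightarrow>\<^sub>E {-int N..int N}"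
    have finF: "finite F" unfolding F_def by (intro finite_PiE) auto
    have cardF: "card F = (2 * N + 1) ^ n"
      unfolding F_def by (subst card_PiE) (auto simp: nat_add_distrib nat_mult_distrib)
    \<comment> \<open>Row 1 of \<open>A\<close> belongs to \<open>x 0\<close>, which exists since
      \<open>1 \<le> s\<close>; thus \<open>h q + of_int (q 0)\<close> is the first gradient
      coefficient.\<close>
    define h where "h q = (\<Sum>j<n - s. A 1 j * of_int (q (s + j)))" for q :: "nat \<Rightarrow> int"
    define F1 where "F1 = {q \<in> F. \<bar>h q + of_int (q 0)\<bar> < 1}"
    have cardF1: "card F1 \<le> 2 * (2 * N + 1) ^ (n - 1)"
      unfolding F1_def F_def using s by (intro card_small_first_gradient) (auto simp: h_def)
    \<comment> \<open>Outside \<open>F1\<close> the first gradient coefficient alone makes the norm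
      at least 1. Inside \<open>F1\<close>, errors below \<open>\<kappa> / Q\<close> are left to
      \<open>L\<close>.\<close>
    define \<tau> where "\<tau> q = (if q \<in> F1 then \<kappa> / Q else 1)" for q
    have \<tau>0: "0 < \<tau> q" for q using \<kappa> Q by (simp add: \<tau>_def)
    have "\<forall>q\<in>F. \<exists>E\<in>sets (lebesgue_space s).
        {x \<in> cube s R. \<exists>k. \<bar>affine_form s (tail_error s n A q k) x\<bar> < \<eta>
          \<and> \<tau> q \<le> max_norm (s + 1) (tail_error s n A q k)} \<subseteq> E
        \<and> ?\<mu> E \<le> ennreal (C * (2 * real s * R + 3 / \<tau> q) * \<eta>)"
    proof
      fix q
      show "\<exists>E\<in>sets (lebesgue_space s).
        {x \<in> cube s R. \<exists>k. \<bar>affine_form s (tail_error s n A q k) x\<bar> < \<eta>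
          \<and> \<tau> q \<le> max_norm (s + 1) (tail_error s n A q k)} \<subseteq> E
        \<and> ?\<mu> E \<le> ennreal (C * (2 * real s * R + 3 / \<tau> q) * \<eta>)"
        using emeasure_slabs_shifted[OF s(1) R \<eta> \<tau>0,
            of "tail_error s n A q 0" "\<Sum>j<n - s. A 0 j * of_int (q (s + j))" q]
        unfolding tail_error_shift[symmetric] C_def .
    qed
    then have "\<exists>E. \<forall>q\<in>F. E q \<in> sets (lebesgue_space s) \<and>
        {x \<in> cube s R. \<exists>k. \<bar>affine_form s (tail_error s n A q k) x\<bar> < \<eta>
          \<and> \<tau> q \<le> max_norm (s + 1) (tail_error s n A q k)} \<subseteq> E q
        \<and> ?\<mu> (E q) \<le> ennreal (C * (2 * real s * R + 3 / \<tau> q) * \<eta>)"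
      unfolding Bex_def by (rule bchoice)
    then obtain E where E: "\<And>q. q \<in> F \<Longrightarrow> E q \<in> sets (lebesgue_space s)"
      "\<And>q x k. \<lbrakk>q \<in> F; x \<in> cube s R; \<bar>affine_form s (tail_error s n A q k) x\<bar> < \<eta>;
         \<tau> q \<le> max_norm (s + 1) (tail_error s n A q k)\<rbrakk> \<Longrightarrow> x \<in> E q"
      "\<And>q. q \<in> F \<Longrightarrow> ?\<mu> (E q) \<le> ennreal (C * (2 * real s * R + 3 / \<tau> q) * \<eta>)"
      by blast
    define small where "small v \<longleftrightarrow> (\<exists>q p. (\<exists>j<n - s. q j \<noteq> 0) \<and> (\<forall>j<n - s. \<bar>real_of_int (q j)\<bar> \<le> Q)
        \<and> v = approx_error (n - s) A q p \<and> max_norm (s + 1) v < \<kappa> / Q)" for v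
    have small_lower: "c / Q ^ n \<le> max_norm (s + 1) v" "0 < max_norm (s + 1) v" if "small v" for v
    proof -
      show "c / Q ^ n \<le> max_norm (s + 1) v" using that lower unfolding small_def by blast
      moreover have "0 < c / Q ^ n" using c Q by simp
      ultimately show "0 < max_norm (s + 1) v" by linarith
    qed
    have small_coll: "\<forall>i<s + 1. \<forall>j<s + 1. v i * w j = v j * w i" if "small v" "small w" for v w
      using that coll Q unfolding small_def small_errors_collinear_def by blast
    \<comment> \<open>Any one small error \<open>w\<close> serves: the others are proportional to it
      and have norm at least \<open>c / Q ^ n\<close>, so their slabs lie in the slab of
      \<open>w\<close> with threshold \<open>M * (\<epsilon> / c)\<close>. Dividing by the norm
      \<open>M\<close> of \<open>w\<close> frees the measure bound from \<open>M\<close> and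
      \<open>Q\<close>.\<close>
    obtain L where L: "L \<in> sets (lebesgue_space s)" "?\<mu> L \<le> ennreal (C / c * \<epsilon>)"
      "\<And>x v. x \<in> cube s R \<Longrightarrow> small v \<Longrightarrow> \<bar>affine_form s v x\<bar> < \<eta> \<Longrightarrow> x \<in> L"
    proof (cases "\<exists>w. small w")
      case False
      with that[of "{}"] show thesis by auto
    next
      case True
      then obtain w where w: "small w" by blast
      define M where "M = max_norm (s + 1) w"
      have M: "0 < M" using small_lower(2)[OF w] by (simp add: M_def)
      define L where "L = {x \<in> cube s R. \<bar>affine_form s w x\<bar> < M * (\<epsilon> / c)}"
      have "?\<mu> L \<le> ennreal (C * (M * (\<epsilon> / c)) / M)"
        unfolding L_def C_def using emeasure_slab[OF s(1) R, of "M * (\<epsilon> / c)" w] M \<epsilon> c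
        by (simp add: M_def)
      then have "?\<mu> L \<le> ennreal (C / c * \<epsilon>)" using M by simp
      moreover have "L \<in> sets (lebesgue_space s)" unfolding L_def by (rule sets_slab)
      moreover have "x \<in> L" if x: "x \<in> cube s R" and v: "small v" "\<bar>affine_form s v x\<bar> < \<eta>" for x v
      proof -
        define V where "V = max_norm (s + 1) v"
        have V: "0 < V" "c / Q ^ n \<le> V" using small_lower[OF v(1)] by (auto simp: V_def)
        have "\<bar>affine_form s w x\<bar> * V \<le> M * \<bar>affine_form s v x\<bar>"
          unfolding V_def M_def using small_coll[OF v(1) w] V
          by (intro collinear_form_bound) (auto simp: V_def)
        also have "\<dots> < M * \<eta>" using v M by simp
        also have "\<dots> = M * (\<epsilon> / c) * (c / Q ^ n)" using c by (simp add: \<eta>_def)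
        also have "\<dots> \<le> M * (\<epsilon> / c) * V" using V M \<epsilon> c by (intro mult_left_mono) auto
        finally have "\<bar>affine_form s w x\<bar> < M * (\<epsilon> / c)"
          using V(1) by (simp only: mult_less_cancel_right_pos)
        with x show ?thesis by (simp add: L_def)
      qed
      ultimately show thesis using that by blast
    qed
    have sub: "{x \<in> cube s R. approximable n \<epsilon> Q (affine_param s n A x)} \<subseteq> L \<union> (\<Union>q\<in>F. E q)"
    proof
      fix x assume "x \<in> {x \<in> cube s R. approximable n \<epsilon> Q (affine_param s n A x)}"
      then obtain q q0 where x: "x \<in> cube s R" and q: "q \<in> F" "\<exists>i<n. q i \<noteq> 0"
        and "\<bar>(\<Sum>i<n. of_int (q i) * affine_param s n A x i) + of_int q0\<bar> < \<eta>"
        unfolding approximable_def F_def N \<eta>_def by blast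
      then have form: "\<bar>affine_form s (tail_error s n A q q0) x\<bar> < \<eta>"
        using dot_affine_param[OF s(2)] by simp
      define V where "V = max_norm (s + 1) (tail_error s n A q q0)"
      have coord: "\<bar>tail_error s n A q q0 i\<bar> \<le> V" if "i < s + 1" for i
        unfolding V_def using that by (rule abs_le_max_norm)
      show "x \<in> L \<union> (\<Union>q\<in>F. E q)"
      proof (cases "V < \<kappa> / Q")
        case True
        \<comment> \<open>If the last \<open>n - s\<close> entries vanished, some nonzero integer
          \<open>q i\<close> with \<open>i < s\<close> would itself be a coordinate of the error,
          contradicting \<open>V < \<kappa> / Q \<le> 1\<close>.\<close>
        have "\<exists>j<n - s. q (s + j) \<noteq> 0"
        proof (rule ccontr)
          assume "\<not> ?thesis"
          then have zero: "q (s + j) = 0" if "j < n - s" for j using that by blast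
          from q(2) obtain i where i: "i < n" "q i \<noteq> 0" by blast
          have "i < s"
          proof (rule ccontr)
            assume "\<not> i < s"
            with i zero[of "i - s"] show False by (simp add: diff_less_mono)
          qed
          then have "\<bar>real_of_int (q i)\<bar> \<le> V"
            using coord[of "Suc i"] zero by (simp add: approx_error_def)
          moreover have "1 \<le> \<bar>real_of_int (q i)\<bar>" using i by linarith
          moreover have "\<kappa> / Q \<le> 1 / 1" using \<kappa> Q by (intro frac_le) auto
          ultimately show False using True by simp
        qed
        moreover have "\<bar>real_of_int (q (s + j))\<bar> \<le> Q" if "j < n - s" for j
        proof -
          have "q (s + j) \<in> {-int N..int N}" using PiE_mem[OF q(1)[unfolded F_def], of "s + j"] that s by simp
          then have "\<bar>q (s + j)\<bar> \<le> int N" by auto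
          with N(2) show ?thesis by linarith
        qed
        ultimately have "small (tail_error s n A q q0)"
          using True unfolding small_def V_def
          by (intro exI[of _ "\<lambda>j. q (s + j)"] exI[of _ "case_nat q0 q"]) auto
        with L(3)[OF x _ form] show ?thesis by blast
      next
        case False
        have "\<tau> q \<le> V"
        proof (cases "q \<in> F1")
          case True
          with False show ?thesis by (simp add: \<tau>_def)
        next
          case nF1: False
          then have "1 \<le> \<bar>h q + of_int (q 0)\<bar>" using q by (simp add: F1_def)
          also have "\<dots> \<le> V" using coord[of 1] s by (simp add: approx_error_def h_def)
          finally show ?thesis using nF1 by (simp add: \<tau>_def)
        qed
        then have "x \<in> E q" using E(2)[OF q(1) x form] by (simp add: V_def)
        with q(1) show ?thesis by blast
      qed
    qed
    define a1 where "a1 = C * (2 * real s * R + 3) * \<eta>"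
    define a2 where "a2 = C * (2 * real s * R + 3 / (\<kappa> / Q)) * \<eta>"
    have a0: "0 \<le> a1" "0 \<le> a2" using C0 R \<kappa> Q \<eta> by (auto simp: a1_def a2_def)
    have "?\<mu> (\<Union>q\<in>F. E q) \<le> (\<Sum>q\<in>F. ?\<mu> (E q))"
      using finF E(1) by (intro emeasure_subadditive_finite) auto
    \<comment> \<open>Every \<open>q\<close> is charged \<open>a1\<close> and those in
      \<open>F1\<close> also \<open>a2\<close>, so that the sum reduces to two
      cardinalities.\<close>
    also have "\<dots> \<le> (\<Sum>q\<in>F. ennreal (a1 + (if q \<in> F1 then a2 else 0)))"
    proof (rule sum_mono)
      fix q assume "q \<in> F"
      have "C * (2 * real s * R + 3 / \<tau> q) * \<eta> \<le> a1 + (if q \<in> F1 then a2 else 0)"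
        using a0 by (auto simp: \<tau>_def a1_def a2_def)
      then show "?\<mu> (E q) \<le> ennreal (a1 + (if q \<in> F1 then a2 else 0))"
        using E(3)[OF \<open>q \<in> F\<close>] by (meson ennreal_leI order.trans)
    qed
    also have "\<dots> = ennreal (\<Sum>q\<in>F. a1 + (if q \<in> F1 then a2 else 0))"
      using a0 by (intro sum_ennreal) auto
    also have "(\<Sum>q\<in>F. a1 + (if q \<in> F1 then a2 else 0)) = real (card F) * a1 + real (card F1) * a2"
    proof -
      have "(\<Sum>q\<in>F. if q \<in> F1 then a2 else 0) = (\<Sum>q\<in>F1. a2)"
        using finF by (subst sum.inter_restrict[symmetric]) (auto simp: F1_def intro!: arg_cong[of _ _ card])
      then show ?thesis by (simp add: sum.distrib)
    qed
    finally have UE: "?\<mu> (\<Union>q\<in>F. E q) \<le> ennreal (real (card F) * a1 + real (card F1) * a2)" .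
    have N3: "real (2 * N + 1) \<le> 3 * Q" using N Q by simp
    have "real (card F) * a1 \<le> 3 ^ n * C * (2 * real s * R + 3) * \<epsilon>"
    proof -
      have "real (card F) \<le> (3 * Q) ^ n"
        unfolding cardF of_nat_power using N3 by (intro power_mono) auto
      then have "real (card F) * a1 \<le> (3 * Q) ^ n * a1" using a0 by (intro mult_right_mono)
      also have "\<dots> = 3 ^ n * C * (2 * real s * R + 3) * \<epsilon>"
        using Q by (simp add: a1_def \<eta>_def power_mult_distrib)
      finally show ?thesis .
    qed
    moreover have "real (card F1) * a2 \<le> 2 * 3 ^ n * C * (2 * real s * R + 3 / \<kappa>) * \<epsilon>"
    proof -
      have "real (card F1) \<le> 2 * real (2 * N + 1) ^ (n - 1)"
        using cardF1 by (metis of_nat_le_iff of_nat_mult of_nat_numeral of_nat_power)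
      also have "\<dots> \<le> 2 * (3 * Q) ^ (n - 1)"
        using N3 by (intro mult_left_mono power_mono) auto
      finally have F1: "real (card F1) \<le> 2 * (3 * Q) ^ (n - 1)" .
      \<comment> \<open>The threshold \<open>\<kappa> / Q\<close> costs a factor \<open>Q\<close>,
        which the exponent \<open>n - 1\<close> in the bound for \<open>card F1\<close>
        compensates.\<close>
      have "2 * real s * R \<le> Q * (2 * real s * R)"
        using Q R mult_right_mono[of 1 Q "2 * real s * R"] by simp
      then have "2 * real s * R + 3 / (\<kappa> / Q) \<le> Q * (2 * real s * R + 3 / \<kappa>)"
        by (simp add: distrib_left mult_ac)
      then have "a2 \<le> C * (Q * (2 * real s * R + 3 / \<kappa>)) * \<eta>"
        unfolding a2_def using C0 \<eta> by (intro mult_right_mono mult_left_mono) auto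
      then have "real (card F1) * a2
          \<le> (2 * (3 * Q) ^ (n - 1)) * (C * (Q * (2 * real s * R + 3 / \<kappa>)) * \<eta>)"
        using F1 a0 Q by (intro mult_mono) auto
      also have "\<dots> = 2 * (3 ^ (n - 1) * (Q ^ (n - 1) * Q)) * C * (2 * real s * R + 3 / \<kappa>) * \<eta>"
        by (simp add: power_mult_distrib mult_ac)
      also have "Q ^ (n - 1) * Q = Q ^ n" using s by (cases n) auto
      also have "2 * (3 ^ (n - 1) * Q ^ n) * C * (2 * real s * R + 3 / \<kappa>) * \<eta>
          = 2 * 3 ^ (n - 1) * C * (2 * real s * R + 3 / \<kappa>) * \<epsilon>"
        using Q by (simp add: \<eta>_def)
      also have "\<dots> \<le> 2 * 3 ^ n * C * (2 * real s * R + 3 / \<kappa>) * \<epsilon>"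
        using C0 R \<kappa> \<epsilon> by (intro mult_right_mono mult_left_mono power_increasing) auto
      finally show ?thesis .
    qed
    ultimately have sum: "real (card F) * a1 + real (card F1) * a2 + C / c * \<epsilon> \<le> K * \<epsilon>"
      unfolding K_def distrib_right by linarith
    have "?\<mu> {x \<in> cube s R. approximable n \<epsilon> Q (affine_param s n A x)} \<le> ?\<mu> (L \<union> (\<Union>q\<in>F. E q))"
      using sub L(1) E(1) finF by (intro emeasure_mono sets.Un sets.finite_UN) auto
    also have "\<dots> \<le> ?\<mu> L + ?\<mu> (\<Union>q\<in>F. E q)"
      using L(1) E(1) finF by (intro emeasure_subadditive sets.finite_UN) auto
    also have "\<dots> \<le> ennreal (C / c * \<epsilon>) + ennreal (real (card F) * a1 + real (card F1) * a2)"
      using L(2) UE by (rule add_mono)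
    also have "\<dots> = ennreal (C / c * \<epsilon> + (real (card F) * a1 + real (card F1) * a2))"
      using C0 c \<epsilon> a0 by (intro ennreal_plus[symmetric]) auto
    also have "\<dots> \<le> ennreal (K * \<epsilon>)"
      using sum by (intro ennreal_leI) linarith
    finally show ?thesis .
  qed
  then show thesis by (rule that)
qed

lemma emeasure_liminf_le:
  assumes B: "\<And>k :: nat. B k \<in> sets M" and le: "\<And>k. emeasure M (B k) \<le> a"
  shows "emeasure M (\<Union>k0. \<Inter>k\<in>{k0..}. B k) \<le> a"
proof -
  define U where "U k0 = (\<Inter>k\<in>{k0..}. B k)" for k0
  have U: "U k0 \<in> sets M" for k0
    unfolding U_def using B by (intro sets.countable_INT') auto
  have "incseq U" by (auto simp: U_def incseq_def)
  then have "emeasure M (\<Union>k0. U k0) = (SUP k0. emeasure M (U k0))"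
    using U by (intro SUP_emeasure_incseq[symmetric]) auto
  also have "\<dots> \<le> a"
  proof (rule SUP_least)
    fix k0
    have "emeasure M (U k0) \<le> emeasure M (B k0)"
      using B by (intro emeasure_mono) (auto simp: U_def)
    with le show "emeasure M (U k0) \<le> a" by (rule order.trans[rotated])
  qed
  finally show ?thesis by (simp add: U_def)
qed

section \<open>Singularity of the matrix and of single points\<close>

text \<open>If \<open>A q + p\<close> is small, the integer vector formed by \<open>p\<close>
  without entry 0, followed by \<open>q\<close>, has a small form at \<open>x\<close>. Since
  \<open>p\<close> may be larger than \<open>q\<close>, the hypothesis is applied at the smaller
  scale \<open>Q / L\<close>.\<close>

lemma singular_vector_affine_param:
  assumes s: "s < n" and A: "omega_singular_matrix (s + 1) (n - s) (real n) A"
  shows "singular_vector n (affine_param s n A x)"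
  unfolding singular_vector_def
proof (intro allI impI)
  fix c :: real assume c: "0 < c"
  \<comment> \<open>\<open>M\<close> converts a bound on the coefficients into one on the form, and
    \<open>L\<close> ensures \<open>H * (Q / L) + 1 \<le> Q\<close> for \<open>Q \<ge> L\<close>.
    The constant \<open>c'\<close> absorbs \<open>M\<close> and the factor \<open>L ^ n\<close> from
    the change of scale; its bound by 1 keeps the errors below 1 and so controls
    \<open>p\<close>.\<close>
  define M where "M = 1 + (\<Sum>i<s. \<bar>x i\<bar>)"
  define H where "H = (\<Sum>i<s + 1. \<Sum>j<n - s. \<bar>A i j\<bar>)"
  define L where "L = H + 1"
  define c' where "c' = min 1 (c / (M * L ^ n))"
  have M: "1 \<le> M" by (simp add: M_def sum_nonneg)
  have H: "0 \<le> H" by (simp add: H_def sum_nonneg)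
  have L: "1 \<le> L" using H by (simp add: L_def)
  have c': "0 < c'" "c' \<le> 1" "M * c' * L ^ n \<le> c"
  proof -
    have pos: "0 < M * L ^ n" using M L by simp
    then show "0 < c'" "c' \<le> 1" using c by (auto simp: c'_def)
    have "c' * (M * L ^ n) \<le> c"
      using pos by (simp add: c'_def pos_le_divide_eq[symmetric])
    then show "M * c' * L ^ n \<le> c" by (simp add: mult_ac)
  qed
  have rows: "(\<Sum>j<n - s. \<bar>A i j\<bar>) \<le> H" if "i < s + 1" for i
    unfolding H_def using that
    by (intro member_le_sum[of i "{..<s + 1}" "\<lambda>i. \<Sum>j<n - s. \<bar>A i j\<bar>"]) (auto simp: sum_nonneg)
  let ?P = "\<lambda>Q. \<exists>(q :: nat \<Rightarrow> int) (p :: nat \<Rightarrow> int). (\<exists>j<n - s. q j \<noteq> 0) \<and>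
      max_norm (s + 1) (approx_error (n - s) A q p) < c' / Q powr real n \<and> max_norm (n - s) (\<lambda>j. of_int (q j)) \<le> Q"
  have "\<forall>\<^sub>F Q in at_top. ?P Q"
    using A c'(1) unfolding omega_singular_matrix_def approx_error_def by blast
  moreover have "filterlim (\<lambda>Q. (1 / L) * Q) at_top at_top"
    using L by (intro filterlim_tendsto_pos_mult_at_top[OF tendsto_const] filterlim_ident) auto
  ultimately have "\<forall>\<^sub>F Q in at_top. ?P ((1 / L) * Q)"
    by (rule eventually_compose_filterlim)
  moreover have "\<forall>\<^sub>F Q in at_top. L \<le> Q" by (rule eventually_ge_at_top)
  ultimately show "\<forall>\<^sub>F Q :: real in at_top. \<exists>(q :: nat \<Rightarrow> int) (q\<^sub>0 :: int).
        (\<exists>i<n. q i \<noteq> 0) \<and>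
        \<bar>(\<Sum>i<n. of_int (q i) * affine_param s n A x i) + of_int q\<^sub>0\<bar> < c / Q ^ n \<and>
        max_norm n (\<lambda>i. of_int (q i)) \<le> Q"
  proof eventually_elim
    case (elim Q)
    define Q' where "Q' = Q / L"
    have Q': "1 \<le> Q'" "Q = L * Q'" using elim(2) L by (auto simp: Q'_def)
    from elim(1) obtain q p :: "nat \<Rightarrow> int" where q: "\<exists>j<n - s. q j \<noteq> 0"
      and err: "max_norm (s + 1) (approx_error (n - s) A q p) < c' / Q' powr real n"
      and qQ: "max_norm (n - s) (\<lambda>j. of_int (q j)) \<le> Q'"
      by (auto simp: Q'_def)
    define \<delta> where "\<delta> = c' / Q' ^ n"
    have \<delta>: "0 < \<delta>" "\<delta> \<le> 1"
    proof -
      have "1 \<le> Q' ^ n" using Q'(1) by (rule one_le_power)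
      then show "0 < \<delta>" "\<delta> \<le> 1" using c' by (auto simp: \<delta>_def)
    qed
    have err': "\<bar>approx_error (n - s) A q p i\<bar> < \<delta>" if "i < s + 1" for i
      using err that Q' by (simp add: max_norm_less_iff powr_realpow \<delta>_def)
    have qQ': "\<bar>real_of_int (q j)\<bar> \<le> Q'" if "j < n - s" for j
      using qQ that by (simp add: max_norm_le_iff)
    define u where "u i = (if i < s then p (Suc i) else q (i - s))" for i
    have err_u: "tail_error s n A u (p 0) i = approx_error (n - s) A q p i" if "i < s + 1" for i
      using that by (cases i) (auto simp: approx_error_def u_def)
    have "\<exists>i<n. u i \<noteq> 0"
    proof -
      from q obtain j where "j < n - s" "q j \<noteq> 0" by blast
      then show ?thesis by (intro exI[of _ "s + j"]) (auto simp: u_def)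
    qed
    moreover have "\<bar>(\<Sum>i<n. of_int (u i) * affine_param s n A x i) + of_int (p 0)\<bar> < c / Q ^ n"
    proof -
      have e: "\<bar>tail_error s n A u (p 0) i\<bar> < \<delta>" if "i < s + 1" for i
        using err' err_u that by simp
      have "\<bar>\<Sum>i<s. tail_error s n A u (p 0) (Suc i) * x i\<bar> \<le> (\<Sum>i<s. \<delta> * \<bar>x i\<bar>)"
        by (intro order.trans[OF sum_abs] sum_mono)
          (auto simp: abs_mult intro!: mult_right_mono e[THEN less_imp_le])
      then have "\<bar>affine_form s (tail_error s n A u (p 0)) x\<bar> < \<delta> + (\<Sum>i<s. \<delta> * \<bar>x i\<bar>)"
        using e[of 0] unfolding affine_form_def by linarith
      also have "\<dots> = M * \<delta>" by (simp add: M_def sum_distrib_left algebra_simps)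
      also have "\<dots> = M * c' * L ^ n / Q ^ n"
        using L Q' by (simp add: \<delta>_def power_mult_distrib)
      also have "\<dots> \<le> c / Q ^ n"
        using c'(3) Q' L by (intro divide_right_mono) auto
      finally show ?thesis by (simp add: dot_affine_param[OF s])
    qed
    moreover have "max_norm n (\<lambda>i. of_int (u i)) \<le> Q"
    proof -
      have "\<bar>real_of_int (u i)\<bar> \<le> Q" if i: "i < n" for i
      proof (cases "i < s")
        case True
        have "\<bar>\<Sum>j<n - s. A (Suc i) j * of_int (q j)\<bar> \<le> (\<Sum>j<n - s. \<bar>A (Suc i) j\<bar> * Q')"
          using qQ' by (intro order.trans[OF sum_abs] sum_mono) (auto simp: abs_mult intro!: mult_left_mono)
        also have "\<dots> = (\<Sum>j<n - s. \<bar>A (Suc i) j\<bar>) * Q'" by (simp add: sum_distrib_right)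
        also have "\<dots> \<le> H * Q'" using rows[of "Suc i"] True Q' by (intro mult_right_mono) auto
        finally have "\<bar>real_of_int (p (Suc i))\<bar> \<le> H * Q' + 1"
          using err'[of "Suc i"] True \<delta> unfolding approx_error_def by simp
        also have "\<dots> \<le> Q" using Q' by (simp add: L_def distrib_right)
        finally show ?thesis using True by (simp add: u_def)
      next
        case False
        have "\<bar>real_of_int (q (i - s))\<bar> \<le> Q'" using False i by (intro qQ') auto
        also have "\<dots> \<le> Q" using Q' L mult_right_mono[of 1 L Q'] by simp
        finally show ?thesis using False by (simp add: u_def)
      qed
      then show ?thesis using Q' L by (auto simp: max_norm_le_iff)
    qed
    ultimately show ?case by blast
  qed
qed

lemma not_AE_False_lebesgue_space: "\<not> (AE x in lebesgue_space s. False)"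
proof
  assume "AE x in lebesgue_space s. False"
  then have "emeasure (lebesgue_space s) (space (lebesgue_space s)) = 0"
    by (subst (asm) AE_iff_measurable[OF _ refl]) auto
  moreover have "emeasure (lebesgue_space s) (cube s 1) \<le> emeasure (lebesgue_space s) (space (lebesgue_space s))"
    by (rule emeasure_space)
  ultimately show False by (simp add: emeasure_cube)
qed

text \<open>For \<open>s = 0\<close> the form is the constant \<open>A q + q0\<close>, so both
  notions state the same inequality for a single row.\<close>

lemma singular_point_imp_omega_singular:
  assumes "0 < n" "singular_vector n (affine_param 0 n A x)"
  shows "omega_singular_matrix 1 n (real n) A"
  unfolding omega_singular_matrix_def
proof (intro allI impI)
  fix c :: real assume c: "0 < c"
  with assms(2) have "\<forall>\<^sub>F Q :: real in at_top. \<exists>(q :: nat \<Rightarrow> int) (q0 :: int). (\<exists>i<n. q i \<noteq> 0) \<and>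
      \<bar>(\<Sum>i<n. of_int (q i) * affine_param 0 n A x i) + of_int q0\<bar> < c / Q ^ n \<and>
      max_norm n (\<lambda>i. of_int (q i)) \<le> Q"
    by (simp add: singular_vector_def)
  moreover have "\<forall>\<^sub>F Q :: real in at_top. 0 < Q" by (rule eventually_gt_at_top)
  ultimately show "\<forall>\<^sub>F Q :: real in at_top. \<exists>(q :: nat \<Rightarrow> int) (p :: nat \<Rightarrow> int). (\<exists>j<n. q j \<noteq> 0) \<and>
        max_norm 1 (\<lambda>i. (\<Sum>j<n. A i j * of_int (q j)) + of_int (p i)) < c / Q powr real n \<and>
        max_norm n (\<lambda>j. of_int (q j)) \<le> Q"
  proof eventually_elim
    case (elim Q)
    then obtain q :: "nat \<Rightarrow> int" and q0 :: int where q: "\<exists>i<n. q i \<noteq> 0" "max_norm n (\<lambda>i. of_int (q i)) \<le> Q"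
      and "\<bar>(\<Sum>i<n. of_int (q i) * affine_param 0 n A x i) + of_int q0\<bar> < c / Q ^ n"
      by blast
    then have "\<bar>(\<Sum>j<n. A 0 j * of_int (q j)) + of_int q0\<bar> < c / Q ^ n"
      using dot_affine_param[of 0 n q A x q0] assms(1) by (simp add: affine_form_def approx_error_def)
    then have "max_norm 1 (\<lambda>i. (\<Sum>j<n. A i j * of_int (q j)) + of_int q0) < c / Q powr real n"
      using c elim(2) by (simp add: max_norm_less_iff powr_realpow)
    with q show ?case by (intro exI[of _ q] exI[of _ "\<lambda>_. q0"]) auto
  qed
qed

section \<open>Null sets along a sequence of scales\<close>

text \<open>Failure of singularity for \<open>A\<close> supplies arbitrarily large scales with the
  lower bound. For each \<open>\<epsilon>\<close> a singular point is approximable at all but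
  finitely many of them, so within a cube its parameter lies in a lower limit of sets of measure
  \<open>O(\<epsilon>)\<close>.\<close>

lemma AE_not_singular:
  assumes s: "1 \<le> s" "s < n" and \<kappa>: "0 < \<kappa>" "\<kappa> \<le> 1"
    and coll: "small_errors_collinear (s + 1) (n - s) A \<kappa>"
    and nonsing: "\<not> omega_singular_matrix (s + 1) (n - s) (real n) A"
  shows "AE y in haar_affine s n A. \<not> singular_vector n y"
proof -
  from nonsing obtain c where c: "0 < c"
    and "\<not> (\<forall>\<^sub>F Q in at_top. \<exists>(q :: nat \<Rightarrow> int) (p :: nat \<Rightarrow> int). (\<exists>j<n - s. q j \<noteq> 0) \<and>
      max_norm (s + 1) (approx_error (n - s) A q p) < c / Q powr real n \<and>
      max_norm (n - s) (\<lambda>j. of_int (q j)) \<le> Q)"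
    unfolding omega_singular_matrix_def approx_error_def by blast
  then have freq: "\<exists>\<^sub>F Q in at_top. \<forall>(q :: nat \<Rightarrow> int) (p :: nat \<Rightarrow> int).
      (\<exists>j<n - s. q j \<noteq> 0) \<longrightarrow> max_norm (n - s) (\<lambda>j. of_int (q j)) \<le> Q \<longrightarrow>
      c / Q powr real n \<le> max_norm (s + 1) (approx_error (n - s) A q p)"
    unfolding not_eventually by (elim frequently_elim1) (meson not_less)
  \<comment> \<open>The bound \<open>real k + 1\<close> makes the chosen scales tend to infinity and
    keeps each of them at least 1.\<close>
  have "\<exists>Q\<ge>real k + 1. \<forall>(q :: nat \<Rightarrow> int) (p :: nat \<Rightarrow> int).
      (\<exists>j<n - s. q j \<noteq> 0) \<longrightarrow> max_norm (n - s) (\<lambda>j. of_int (q j)) \<le> Q \<longrightarrow>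
      c / Q powr real n \<le> max_norm (s + 1) (approx_error (n - s) A q p)" for k :: nat
    using freq unfolding frequently_def eventually_at_top_linorder by blast
  then obtain Q where Q: "\<And>k. real k + 1 \<le> Q k" and
    lower_powr: "\<And>k (q :: nat \<Rightarrow> int) p. \<exists>j<n - s. q j \<noteq> 0 \<Longrightarrow> max_norm (n - s) (\<lambda>j. of_int (q j)) \<le> Q k \<Longrightarrow>
      c / Q k powr real n \<le> max_norm (s + 1) (approx_error (n - s) A q p)"
    by metis
  have Qk: "real k \<le> Q k" for k using Q[of k] by linarith
  have Q1: "1 \<le> Q k" for k using Q[of k] by linarith
  have lower: "c / Q k ^ n \<le> max_norm (s + 1) (approx_error (n - s) A q p)"
    if "\<exists>j<n - s. q j \<noteq> 0" "\<forall>j<n - s. \<bar>real_of_int (q j)\<bar> \<le> Q k" for k q p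
    using lower_powr[of q k p] that Q1[of k] by (simp add: max_norm_le_iff powr_realpow)
  have Qlim: "filterlim Q at_top sequentially"
    by (rule filterlim_at_top_mono[OF filterlim_real_sequentially]) (simp add: Qk)
  let ?N = "restrict_space (\<Pi>\<^sub>M i\<in>{..<n}. (borel :: real measure)) (affine_subspace s n A)"
  let ?f = "affine_param s n A"
  define \<epsilon> where "\<epsilon> m = 1 / (real m + 1)" for m
  have \<epsilon>: "0 < \<epsilon> m" "\<epsilon> m \<le> 1" for m by (auto simp: \<epsilon>_def)
  \<comment> \<open>\<open>Z\<close> weakens singularity to countably many constants and scales. It
    is therefore measurable, which allows the passage from the parameter space to the image
    measure.\<close>
  define Z where "Z y \<longleftrightarrow> (\<forall>m. \<exists>k0. \<forall>k\<ge>k0. approximable n (\<epsilon> m) (Q k) y)" for y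
  have singZ: "Z y" if "singular_vector n y" for y
    unfolding Z_def
  proof
    fix m
    have "\<forall>\<^sub>F k in sequentially. approximable n (\<epsilon> m) (Q k) y"
      using eventually_compose_filterlim[OF eventually_approximable[OF that \<epsilon>(1)] Qlim] .
    then show "\<exists>k0. \<forall>k\<ge>k0. approximable n (\<epsilon> m) (Q k) y"
      by (simp add: eventually_sequentially)
  qed
  have predN: "Measurable.pred ?N (approximable n (\<epsilon> m) (Q k))" for m k
    by (rule measurable_restrict_space1) (rule pred_approximable)
  note [measurable] = predN measurable_affine_param[of s n A]
  have predZ: "Measurable.pred ?N Z"
    unfolding Z_def by measurable
  \<comment> \<open>The cubes exhaust the parameter space, and the constant \<open>K\<close> may
    depend on \<open>r\<close>.\<close>
  have "AE x in lebesgue_space s. x \<in> cube s (real r + 1) \<longrightarrow> \<not> Z (?f x)" for r :: nat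
  proof -
    let ?B = "\<lambda>m k. {x \<in> cube s (real r + 1). approximable n (\<epsilon> m) (Q k) (?f x)}"
    obtain K where K: "\<And>m k. emeasure (lebesgue_space s) (?B m k) \<le> ennreal (K * \<epsilon> m)"
    proof (rule emeasure_approximable[OF s _ \<kappa> c coll])
      show "1 \<le> real r + 1" by simp
      fix K assume "\<And>Q \<epsilon>. 1 \<le> Q \<Longrightarrow> 0 < \<epsilon> \<Longrightarrow> \<epsilon> \<le> 1 \<Longrightarrow>
        (\<And>q p. \<exists>j<n - s. q j \<noteq> 0 \<Longrightarrow> \<forall>j<n - s. \<bar>real_of_int (q j)\<bar> \<le> Q \<Longrightarrow>
          c / Q ^ n \<le> max_norm (s + 1) (approx_error (n - s) A q p)) \<Longrightarrow>
        emeasure (lebesgue_space s) {x \<in> cube s (real r + 1). approximable n \<epsilon> Q (?f x)} \<le> ennreal (K * \<epsilon>)"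
      then show thesis
        using Q1 \<epsilon> lower by (intro that) blast+
    qed
    have B: "?B m k \<in> sets (lebesgue_space s)" for m k
    proof -
      have "Measurable.pred (lebesgue_space s) (\<lambda>x. approximable n (\<epsilon> m) (Q k) (?f x))"
        by (rule measurable_compose[OF measurable_affine_param predN])
      then have "{x \<in> space (lebesgue_space s). approximable n (\<epsilon> m) (Q k) (?f x)} \<in> sets (lebesgue_space s)"
        by (rule predE)
      then have "cube s (real r + 1) \<inter> {x \<in> space (lebesgue_space s). approximable n (\<epsilon> m) (Q k) (?f x)}
          \<in> sets (lebesgue_space s)"
        by (rule sets.Int[OF sets_cube])
      also have "cube s (real r + 1) \<inter> {x \<in> space (lebesgue_space s). approximable n (\<epsilon> m) (Q k) (?f x)} = ?B m k"
        by (auto simp: space_PiM)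
      finally show ?thesis .
    qed
    let ?Z = "\<Inter>m. \<Union>k0. \<Inter>k\<in>{k0..}. ?B m k"
    have setsZ: "?Z \<in> sets (lebesgue_space s)"
      using B by (intro sets.countable_INT' sets.countable_UN' ) auto
    have "emeasure (lebesgue_space s) ?Z \<le> ennreal (K * \<epsilon> m)" for m
    proof -
      have "emeasure (lebesgue_space s) ?Z \<le> emeasure (lebesgue_space s) (\<Union>k0. \<Inter>k\<in>{k0..}. ?B m k)"
        using B by (intro emeasure_mono sets.countable_INT' sets.countable_UN') auto
      also have "\<dots> \<le> ennreal (K * \<epsilon> m)"
        by (rule emeasure_liminf_le[OF B K])
      finally show ?thesis .
    qed
    moreover have "(\<lambda>m. ennreal (K * \<epsilon> m)) \<longlonglongrightarrow> ennreal 0"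
    proof (rule tendsto_ennrealI)
      have "(\<lambda>m. K * (1 / (real m + 1))) \<longlonglongrightarrow> K * 0"
        using LIMSEQ_inverse_real_of_nat by (intro tendsto_mult_left) (simp add: inverse_eq_divide add.commute)
      then show "(\<lambda>m. K * \<epsilon> m) \<longlonglongrightarrow> 0" by (simp add: \<epsilon>_def)
    qed
    ultimately have "emeasure (lebesgue_space s) ?Z \<le> ennreal 0"
      by (intro LIMSEQ_le_const[of _ "ennreal 0"]) auto
    then have "?Z \<in> null_sets (lebesgue_space s)"
      using setsZ by (intro null_setsI) simp_all
    then show ?thesis
    proof (rule AE_I'[rule_format])
      show "{x \<in> space (lebesgue_space s). \<not> (x \<in> cube s (real r + 1) \<longrightarrow> \<not> Z (?f x))} \<subseteq> ?Z"
        by (auto simp: Z_def) blast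
    qed
  qed
  then have "AE x in lebesgue_space s. \<forall>r :: nat. x \<in> cube s (real r + 1) \<longrightarrow> \<not> Z (?f x)"
    by (simp only: AE_all_countable) blast
  then have "AE x in lebesgue_space s. \<not> Z (?f x)"
  proof (rule AE_mp[OF _ AE_I2], intro impI)
    fix x assume x: "x \<in> space (lebesgue_space s)"
      and not: "\<forall>r :: nat. x \<in> cube s (real r + 1) \<longrightarrow> \<not> Z (?f x)"
    obtain r :: nat where r: "(\<Sum>i<s. \<bar>x i\<bar>) \<le> real r" using real_arch_simple by blast
    have "x i \<in> {-(real r + 1)..real r + 1}" if "i < s" for i
    proof -
      have "\<bar>x i\<bar> \<le> (\<Sum>i<s. \<bar>x i\<bar>)"
        using that by (intro member_le_sum[of i "{..<s}" "\<lambda>i. \<bar>x i\<bar>"]) auto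
      with r show ?thesis by (auto simp: abs_le_iff)
    qed
    with x have "x \<in> cube s (real r + 1)" by (auto simp: space_PiM PiE_iff)
    with not show "\<not> Z (?f x)" by blast
  qed
  then have "AE y in haar_affine s n A. \<not> Z y"
    unfolding haar_affine_def using predZ
    by (subst AE_distr_iff[OF measurable_affine_param]) (auto simp: pred_def)
  then show ?thesis
    by (rule AE_mp[OF _ AE_I2]) (use singZ in blast)
qed

theorem theorem1p6:
  fixes s n :: nat and A :: "nat \<Rightarrow> nat \<Rightarrow> real"
  assumes "s < n"
    and "columns_rational_multiples (s + 1) (n - s) A \<or>
         rows_rational_multiples (s + 1) (n - s) A"
  shows "\<not> omega_singular_matrix (s + 1) (n - s) (real n) A \<longleftrightarrow>
         (AE y in haar_affine s n A. \<not> singular_vector n y)"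
proof
  assume nonsing: "\<not> omega_singular_matrix (s + 1) (n - s) (real n) A"
  show "AE y in haar_affine s n A. \<not> singular_vector n y"
  proof (cases "s = 0")
    case True
    show ?thesis
    proof (rule AE_I2)
      fix y assume "y \<in> space (haar_affine s n A)"
      then obtain x where "y = affine_param 0 n A x"
        using True by (auto simp: space_haar_affine affine_subspace_def)
      with singular_point_imp_omega_singular[of n A x] nonsing True assms(1)
      show "\<not> singular_vector n y" by auto
    qed
  next
    case False
    obtain \<kappa> where "0 < \<kappa>" "\<kappa> \<le> 1" "small_errors_collinear (s + 1) (n - s) A \<kappa>"
      using assms(2) small_errors_collinear_rows small_errors_collinear_columns by metis
    with False assms(1) nonsing show ?thesis
      by (intro AE_not_singular) auto
  qed
next
  assume AE: "AE y in haar_affine s n A. \<not> singular_vector n y"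
  show "\<not> omega_singular_matrix (s + 1) (n - s) (real n) A"
  proof
    assume "omega_singular_matrix (s + 1) (n - s) (real n) A"
    then have "singular_vector n (affine_param s n A x)" for x
      using assms(1) by (rule singular_vector_affine_param[rotated])
    with AE_distrD[OF measurable_affine_param AE[unfolded haar_affine_def]]
    have "AE x in lebesgue_space s. False" by simp
    with not_AE_False_lebesgue_space show False by blast
  qed
qed

end
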